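(* Let $m,p,r\in\mathbb{N}$ and let $f\in C^r(\mathbb{R}_+)\cap\mathcal{D}^{p+r}\cap\mathcal{K}^{p+2m+r}$. Then $$\Sigma^{m+1}f^{(r)}(x)=\rho_1^{m+1}[D^r\Sigma^{m+1}f](x-1)\qquad(x>0).$$
   Context: $\mathbb{N}$ is the set of nonnegative integers, $\mathbb{R}_+=(0,\infty)$, $\Delta f(x)=f(x+1)-f(x)$, and $\binom{x}{j}=x(x-1)\cdots(x-j+1)/j!$ for real $x$ and $j\in\mathbb{N}$. $D$ is the derivative operator, $f^{(r)}=D^rf$, and $C^r(\mathbb{R}_+)$ is the space of $r$ times continuously differentiable real functions on $\mathbb{R}_+$. For $a>0$, $p\in\mathbb{N}$ and $f\colon\mathbb{R}_+\to\mathbb{R}$, the function $\rho_a^p[f]\colon(-a,\infty)\to\mathbb{R}$ is defined by $\rho_a^p[f](x)=f(x+a)-\sum_{j=0}^{p-1}\binom{x}{j}\Delta^jf(a)$. For an integer $p\ge -1$, a function $f$ on a real interval $I$ is $p$-convex if its divided difference $f[x_0,\dots,x_{p+1}]$ is $\ge 0$ at any $p+2$ pairwise distinct points of $I$, and $p$-concave if $-f$ is $p$-convex. For $p\in\mathbb{N}$, $\mathcal{D}^p$ is the set of functions $f\colon\mathbb{R}_+\to\mathbb{R}$ such that $\Delta^pf(n)\to0$ as the integer $n\to\infty$. For an integer $p\ge-1$, $\mathcal{K}^p$ is the set of functions $f\colon\mathbb{R}_+\to\mathbb{R}$ that are eventually $p$-convex or eventually $p$-concave (i.e. $p$-convex,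 or $p$-concave, on some half-line $(M,\infty)$). Definition of $\Sigma$ (known well-definedness): $\mathrm{dom}\,\Sigma=\bigcup_{p\ge0}(\mathcal{D}^p\cap\mathcal{K}^p)$. If $g\in\mathcal{D}^p\cap\mathcal{K}^p$, then $\Sigma g\colon\mathbb{R}_+\to\mathbb{R}$ is the unique solution $f\in\mathcal{K}^p$ of $\Delta f=g$ on $\mathbb{R}_+$ with $f(1)=0$; it is given by the pointwise limit $$\Sigma g(x)=\lim_{n\to\infty}\Big(\sum_{k=1}^{n-1}g(k)-\sum_{k=0}^{n-1}g(x+k)+\sum_{j=1}^p\binom{x}{j}\Delta^{j-1}g(n)\Big),$$ and it does not depend on the choice of $p$. Iterates: $\Sigma^0=\mathrm{id}$, $\Sigma^{m+1}=\Sigma\circ\Sigma^m$; $g\in\mathrm{dom}\,\Sigma^{m+1}$ means $g\in\mathrm{dom}\,\Sigma^m$ and $\Sigma^mg\in\mathrm{dom}\,\Sigma$. It is known that $\mathcal{D}^p\cap\mathcal{K}^{p+m}\subset\mathrm{dom}\,\Sigma^{m+1}$, and that if $g\in C^r(\mathbb{R}_+)\cap\mathcal{D}^p\cap\mathcal{K}^{\max\{p,r\}}$ then $\Sigma g\in C^r(\mathbb{R}_+)\cap\mathcal{D}^{p+1}\cap\mathcal{K}^{\max\{p,r\}}$. *)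

theory Defs
  imports "HOL-Analysis.Analysis"
begin

text \<open>
  A function on the open half-line of positive reals is represented by a function
  \<open>real \<Rightarrow> real\<close> whose values outside \<open>{0<..}\<close> are irrelevant.
\<close>

definition Delta :: "(real \<Rightarrow> real) \<Rightarrow> real \<Rightarrow> real" where
  "Delta f x = f (x + 1) - f x"

text \<open>Meaningful for \<open>a > 0\<close> and \<open>x > - a\<close>.\<close>

definition rho :: "real \<Rightarrow> nat \<Rightarrow> (real \<Rightarrow> real) \<Rightarrow> real \<Rightarrow> real" where
  "rho a p f x = f (x + a) - (\<Sum>j<p. (x gchoose j) * (Delta ^^ j) f a)"

text \<open>
  The divided difference at the pairwise distinct points of a finite set \<open>X\<close>. Being
  symmetric in its points, it is indexed by the set; the usual recursion is
  \<open>divided_difference_insert_insert\<close> below.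
\<close>

definition divided_difference :: "(real \<Rightarrow> real) \<Rightarrow> real set \<Rightarrow> real" where
  "divided_difference f X = (\<Sum>x\<in>X. f x / (\<Prod>y\<in>X - {x}. x - y))"

lemma divided_difference_singleton: "divided_difference f {x} = f x"
  by (simp add: divided_difference_def)

lemma divided_difference_insert_insert:
  assumes "finite S" "x \<notin> S" "y \<notin> S" "x \<noteq> y"
  shows "divided_difference f (insert x (insert y S)) =
    (divided_difference f (insert y S) - divided_difference f (insert x S)) / (y - x)"
proof -
  define P where "P z = (\<Prod>w\<in>S - {z}. z - w)" for z
  have ins: "divided_difference f (insert u S) =
      f u / P u + (\<Sum>z\<in>S. f z / ((z - u) * P z))" if "u \<notin> S" for u
  proof -
    have "(\<Prod>w\<in>insert u S - {z}. z - w) = (z - u) * P z" if "z \<in> S" for z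
    proof -
      have "insert u S - {z} = insert u (S - {z})" using that \<open>u \<notin> S\<close> by auto
      then show ?thesis using assms(1) \<open>u \<notin> S\<close> by (simp add: P_def)
    qed
    moreover have "insert u S - {u} = S - {u}" by auto
    ultimately show ?thesis
      using assms(1) that by (simp add: divided_difference_def P_def)
  qed
  have "(\<Prod>w\<in>insert x (insert y S) - {z}. z - w) = (z - x) * ((z - y) * P z)" if "z \<in> S" for z
  proof -
    have "insert x (insert y S) - {z} = insert x (insert y (S - {z}))" using that assms by auto
    then show ?thesis using assms by (simp add: P_def)
  qed
  moreover have "insert x (insert y S) - {x} = insert y (S - {x})"
    "insert x (insert y S) - {y} = insert x (S - {y})" using assms by auto
  ultimately have all: "divided_difference f (insert x (insert y S)) =
      f x / ((x - y) * P x) + (f y / ((y - x) * P y) +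
      (\<Sum>z\<in>S. f z / ((z - x) * ((z - y) * P z))))"
    using assms by (simp add: divided_difference_def P_def)
  have tm: "f z / ((z - x) * ((z - y) * P z)) =
      (f z / ((z - y) * P z) - f z / ((z - x) * P z)) / (y - x)" if "z \<in> S" for z
  proof -
    have nz: "z \<noteq> x" "z \<noteq> y" using that assms by auto
    moreover have "P z \<noteq> 0" using assms(1) by (auto simp: P_def)
    ultimately show ?thesis using assms(4) by (simp add: divide_simps) (simp add: algebra_simps)
  qed
  have "(\<Sum>z\<in>S. f z / ((z - x) * ((z - y) * P z))) =
      ((\<Sum>z\<in>S. f z / ((z - y) * P z)) - (\<Sum>z\<in>S. f z / ((z - x) * P z))) / (y - x)"
    by (simp add: tm sum_subtractf flip: sum_divide_distrib)
  moreover have "f x / ((x - y) * P x) = - (f x / P x) / (y - x)"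
  proof -
    have "(x - y) * P x = - ((y - x) * P x)" by (simp add: algebra_simps)
    then show ?thesis by (simp add: mult.commute)
  qed
  ultimately show ?thesis
    unfolding all ins[OF assms(2)] ins[OF assms(3)]
    by (simp add: diff_divide_distrib add_divide_distrib mult.commute)
qed

definition pconvex_on :: "nat \<Rightarrow> real set \<Rightarrow> (real \<Rightarrow> real) \<Rightarrow> bool" where
  "pconvex_on p I f \<longleftrightarrow>
    (\<forall>X. X \<subseteq> I \<and> finite X \<and> card X = p + 2 \<longrightarrow> divided_difference f X \<ge> 0)"

definition pconcave_on :: "nat \<Rightarrow> real set \<Rightarrow> (real \<Rightarrow> real) \<Rightarrow> bool" where
  "pconcave_on p I f \<longleftrightarrow> pconvex_on p I (\<lambda>x. - f x)"

definition Dset :: "nat \<Rightarrow> (real \<Rightarrow> real) set" where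
  "Dset p = {f. (\<lambda>n::nat. (Delta ^^ p) f (real n)) \<longlonglongrightarrow> 0}"

definition Kset :: "nat \<Rightarrow> (real \<Rightarrow> real) set" where
  "Kset p = {f. \<exists>M\<ge>0. pconvex_on p {M<..} f \<or> pconcave_on p {M<..} f}"

definition Cset :: "nat \<Rightarrow> (real \<Rightarrow> real) set" where
  "Cset r = {f. (\<forall>k<r. \<forall>x>0. (deriv ^^ k) f differentiable at x) \<and>
                continuous_on {0<..} ((deriv ^^ r) f)}"

definition dom_Sigma :: "(real \<Rightarrow> real) set" where
  "dom_Sigma = (\<Union>p. Dset p \<inter> Kset p)"

text \<open>
  The condition \<open>F \<in> extensional {0<..}\<close> only fixes the irrelevant values
  outside the half-line, so that the solution is unique as a function \<open>real \<Rightarrow> real\<close>.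
\<close>

definition Sigma_op :: "(real \<Rightarrow> real) \<Rightarrow> real \<Rightarrow> real" where
  "Sigma_op g = (THE F. F \<in> extensional {0<..} \<and> (\<forall>x>0. Delta F x = g x) \<and> F 1 = 0 \<and>
                        (\<exists>p. g \<in> Dset p \<inter> Kset p \<and> F \<in> Kset p))"

fun dom_Sigma_pow :: "nat \<Rightarrow> (real \<Rightarrow> real) set" where
  "dom_Sigma_pow 0 = UNIV"
| "dom_Sigma_pow (Suc m) = {g \<in> dom_Sigma_pow m. (Sigma_op ^^ m) g \<in> dom_Sigma}"

end

theory Submission
  imports Defs
begin

text \<open>
  Write \<open>g\<close> for the \<open>r\<close>-th derivative of \<open>f\<close> and \<open>u\<^sub>k\<close> for the \<open>r\<close>-th derivative of \<open>\<Sigma>\<^sup>k f\<close>. Since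
  differences and derivatives commute, \<open>\<Delta>u\<^sub>k\<^sub>+\<^sub>1 = u\<^sub>k\<close>, and by Pascal's rule (\<open>Delta_rho\<close>) the function
  \<open>x \<mapsto> rho 1 (k + 1) u\<^sub>k\<^sub>+\<^sub>1 (x - 1)\<close> has the difference \<open>rho 1 k u\<^sub>k (x - 1)\<close>. Inductively the latter is
  \<open>\<Sigma>\<^sup>k g x\<close>. As \<open>rho\<close> is the error of Newton interpolation, the former vanishes at \<open>x = 1\<close>, and it has
  the convexity of \<open>u\<^sub>k\<^sub>+\<^sub>1\<close>, since polynomials of low degree do not affect higher-order convexity. It is
  therefore the solution that characterizes \<open>\<Sigma>\<^sup>k\<^sup>+\<^sup>1 g\<close>.

  This argument rests on the theory of \<open>\<Sigma>\<close>, whose key is that divided differences of order \<open>p\<close> of a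
  \<open>p\<close>-convex function increase in each node (\<open>divided_difference_mono\<close>). Hence the Newton error
  \<open>rho a (p + 1) f x\<close> is bounded by an increment of \<open>(Delta ^^ p) f\<close> (\<open>abs_rho_le_pconvex\<close>). If \<open>\<Delta>f = g\<close>
  with \<open>g \<in> Dset p\<close>, the error tends to 0 as \<open>a \<rightarrow> \<infinity>\<close>, so that \<open>f\<close> is determined by \<open>g\<close> and \<open>f 1\<close>
  (\<open>difference_equation_unique\<close>); applied to \<open>g\<close> itself, the bound is summable over \<open>a = 1, 2, \<dots>\<close>,
  locally uniformly in \<open>x\<close>, which yields existence and continuity of the solution
  (\<open>difference_equation_solvable\<close>).

  Smoothness of \<open>\<Sigma>g\<close> is obtained from uniqueness too. A derivative lowers both the order of convexity and
  the order of decay by one, so \<open>\<Sigma>g'\<close> exists and is continuous; an antiderivative of it, corrected by a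
  linear function, is a solution for \<open>g\<close> with the right convexity (\<open>pconvex_on_antiderivative\<close>), hence
  equals \<open>\<Sigma>g\<close> (\<open>Sigma_op_has_derivative\<close>).
\<close>

section \<open>Divided differences\<close>

lemma divided_difference_cong:
  assumes "\<And>x. x \<in> X \<Longrightarrow> f x = g x"
  shows "divided_difference f X = divided_difference g X"
  using assms by (simp add: divided_difference_def)

lemma divided_difference_add:
  "divided_difference (\<lambda>x. f x + g x) X = divided_difference f X + divided_difference g X"
  by (simp add: divided_difference_def add_divide_distrib sum.distrib)

lemma divided_difference_diff:
  "divided_difference (\<lambda>x. f x - g x) X = divided_difference f X - divided_difference g X"
  by (simp add: divided_difference_def diff_divide_distrib sum_subtractf)

lemma divided_difference_cmult:
  "divided_difference (\<lambda>x. c * f x) X = c * divided_difference f X"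
  by (simp add: divided_difference_def sum_distrib_left)

lemma divided_difference_sum:
  "divided_difference (\<lambda>x. \<Sum>i\<in>I. f i x) X = (\<Sum>i\<in>I. divided_difference (f i) X)"
  unfolding divided_difference_def by (simp add: sum_divide_distrib) (rule sum.swap)

lemma tendsto_divided_difference:
  assumes "\<And>x. x \<in> X \<Longrightarrow> ((\<lambda>n. f n x) \<longlongrightarrow> g x) F"
  shows "((\<lambda>n. divided_difference (f n) X) \<longlongrightarrow> divided_difference g X) F"
  unfolding divided_difference_def divide_inverse
  by (intro tendsto_sum tendsto_mult_right assms)

lemma divided_difference_mult_root:
  assumes "finite S" "a \<notin> S"
  shows "divided_difference (\<lambda>x. (x - a) * f x) (insert a S) = divided_difference f S"
proof -
  have "(\<Prod>y\<in>insert a S - {z}. z - y) = (z - a) * (\<Prod>y\<in>S - {z}. z - y)" if "z \<in> S" for z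
  proof -
    have "insert a S - {z} = insert a (S - {z})" using that assms by auto
    then show ?thesis using assms by simp
  qed
  moreover have "z \<noteq> a" if "z \<in> S" for z
    using that assms by auto
  ultimately show ?thesis
    using assms by (simp add: divided_difference_def)
qed

lemma divided_difference_affine:
  assumes "finite X" "c \<noteq> 0"
  shows "divided_difference (\<lambda>x. f (c * x + t)) X =
    c ^ (card X - 1) * divided_difference f ((\<lambda>x. c * x + t) ` X)"
proof -
  let ?h = "\<lambda>x. c * x + t"
  have inj: "inj_on ?h A" for A
    using assms(2) by (auto intro: inj_onI)
  have "(\<Prod>y\<in>?h ` X - {?h x}. ?h x - y) = c ^ (card X - 1) * (\<Prod>y\<in>X - {x}. x - y)"
    if "x \<in> X" for x
  proof -
    have "?h ` X - {?h x} = ?h ` (X - {x})"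
      using assms(2) by auto
    then have "(\<Prod>y\<in>?h ` X - {?h x}. ?h x - y) = (\<Prod>y\<in>X - {x}. ?h x - ?h y)"
      by (simp add: prod.reindex[OF inj])
    also have "\<dots> = (\<Prod>y\<in>X - {x}. c * (x - y))"
      by (simp add: right_diff_distrib)
    also have "\<dots> = c ^ (card X - 1) * (\<Prod>y\<in>X - {x}. x - y)"
      using that assms(1) by (simp add: prod.distrib)
    finally show ?thesis .
  qed
  then show ?thesis
    using assms(2) by (simp add: divided_difference_def sum.reindex[OF inj] sum_distrib_left)
qed

lemma divided_difference_translate:
  assumes "finite X"
  shows "divided_difference (\<lambda>x. f (x + t)) X = divided_difference f ((\<lambda>x. x + t) ` X)"
  using divided_difference_affine[OF assms, of 1 f t] by simp

lemma divided_difference_const: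
  assumes "finite X" "card X \<ge> 2"
  shows "divided_difference (\<lambda>x. c) X = 0"
  using assms
proof (induction "card X" arbitrary: X rule: less_induct)
  case less
  from less.prems obtain a Y where Y: "X = insert a Y" "a \<notin> Y" "card Y \<ge> 1" "finite Y"
    by (metis One_nat_def Suc_1 Suc_le_mono card_Suc_eq_finite card_le_Suc_iff finite_insert)
  then obtain b Z where Z: "Y = insert b Z" "b \<notin> Z" "finite Z"
    by (metis One_nat_def card_le_Suc_iff)
  show ?case
  proof (cases "Z = {}")
    case True
    then show ?thesis
      using divided_difference_insert_insert[of "{}" a b "\<lambda>x. c"] Y Z
      by (simp add: divided_difference_singleton)
  next
    case False
    then have "card Z \<ge> 1"
      using Z by (simp add: Suc_leI card_gt_0_iff)
    then have "divided_difference (\<lambda>x. c) (insert b Z) = 0" "divided_difference (\<lambda>x. c) (insert a Z) = 0"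
      using Y Z by (auto intro!: less.hyps)
    then show ?thesis
      using Y Z divided_difference_insert_insert[of Z a b "\<lambda>x. c"] by simp
  qed
qed

text \<open>Divided differences of order \<open>j + 1\<close> or more kill polynomials of degree \<open>j\<close>. Splitting off
  a node \<open>a\<close> of \<open>X\<close> from the last factor, \<open>x + c - j = (x - a) + (a + c - j)\<close>, yields
  a product whose root \<open>a\<close> cancels together with that node, and a polynomial of lower degree.\<close>

lemma divided_difference_gchoose:
  assumes "finite X" "card X \<ge> j + 2"
  shows "divided_difference (\<lambda>x. (x + c) gchoose j) X = 0"
  using assms
proof (induction j arbitrary: X)
  case 0
  then show ?case by (simp add: divided_difference_const)
next
  case (Suc j)
  then obtain a S where X: "X = insert a S" "a \<notin> S" "card S \<ge> j + 2" "finite S"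
    by (metis add_Suc card_le_Suc_iff finite_insert)
  have "((x + c) gchoose Suc j) =
      (1 / (real j + 1)) * ((x - a) * ((x + c) gchoose j) + (a + c - j) * ((x + c) gchoose j))" for x
    by (simp add: gbinomial_prod_rev divide_simps) (simp add: algebra_simps)
  then have "divided_difference (\<lambda>x. (x + c) gchoose Suc j) X =
     (1 / (real j + 1)) * (divided_difference (\<lambda>x. (x - a) * ((x + c) gchoose j)) X
       + (a + c - j) * divided_difference (\<lambda>x. (x + c) gchoose j) X)"
    by (simp only: divided_difference_cmult divided_difference_add)
  also have "\<dots> = 0"
    using X Suc.IH[of S] Suc.IH[of X] by (simp add: divided_difference_mult_root)
  finally show ?case .
qed

section \<open>Higher-order convexity\<close>

lemma pconvex_onD:
  "pconvex_on p I f \<Longrightarrow> X \<subseteq> I \<Longrightarrow> finite X \<Longrightarrow> card X = p + 2 \<Longrightarrow> divided_difference f X \<ge> 0"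
  by (simp add: pconvex_on_def)

text \<open>The divided differences of order \<open>p\<close> of a \<open>p\<close>-convex function increase in each node. Several
  nodes can be moved to the right one after the other, the largest one first, so that a moving
  node never meets another one; \<open>Z\<close> collects the nodes that are already in place.\<close>

lemma divided_difference_mono:
  assumes f: "pconvex_on p {M<..} f"
    and "finite X" "finite Z" "inj_on h X" "\<And>x. x \<in> X \<Longrightarrow> x \<le> h x"
      "Z \<inter> (X \<union> h ` X) = {}" "X \<union> Z \<subseteq> {M<..}" "card (X \<union> Z) = p + 1"
  shows "divided_difference f (X \<union> Z) \<le> divided_difference f (h ` X \<union> Z)"
  using assms(2-)
proof (induction X arbitrary: Z rule: finite_linorder_max_induct)
  case empty
  then show ?case by simp
next
  case (insert b A)
  define S where "S = A \<union> Z"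
  have bS: "b \<notin> S" "finite S" "S \<subseteq> {M<..}" "b > M"
    using insert by (auto simp: S_def)
  have card: "card S = p"
    using insert.prems(6) bS by (simp add: S_def)
  have hb: "b \<le> h b" "h b \<notin> S" "h b \<notin> A" "h b > M"
    using insert.hyps(2) insert.prems(3,4) bS(4) by (fastforce simp: S_def)+
  have step: "divided_difference f (insert b S) \<le> divided_difference f (insert (h b) S)"
  proof (cases "b = h b")
    case False
    then have "b < h b" using hb by simp
    moreover have "divided_difference f (insert b (insert (h b) S)) \<ge> 0"
      using f by (rule pconvex_onD) (use bS hb card False in auto)
    ultimately show ?thesis
      using divided_difference_insert_insert[OF bS(2) bS(1) hb(2) False, of f]
      by (simp add: zero_le_divide_iff)
  qed simp
  have "divided_difference f (A \<union> insert (h b) Z) \<le> divided_difference f (h ` A \<union> insert (h b) Z)"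
  proof (rule insert.IH)
    have "h b \<notin> h ` A"
      using insert.hyps(2) insert.prems(2) by (auto simp: inj_on_def)
    then show "insert (h b) Z \<inter> (A \<union> h ` A) = {}"
      using insert.prems(4) hb by auto
    have "A \<union> insert (h b) Z = insert (h b) S"
      by (auto simp: S_def)
    then show "card (A \<union> insert (h b) Z) = p + 1"
      using card bS hb by simp
  qed (use insert.prems bS hb in \<open>auto simp: S_def\<close>)
  then show ?case
    using step by (simp add: S_def insert_commute)
qed

lemma divided_difference_image_mono:
  assumes "pconvex_on p {M<..} f" "finite X" "inj_on h X" "\<And>x. x \<in> X \<Longrightarrow> x \<le> h x"
    "X \<subseteq> {M<..}" "card X = p + 1"
  shows "divided_difference f X \<le> divided_difference f (h ` X)"
  using divided_difference_mono[of p M f X "{}" h] assms by simp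

lemma divided_difference_translate_mono:
  assumes "pconvex_on (Suc p) {M<..} f" "X \<subseteq> {M<..}" "finite X" "card X = p + 2" "t \<ge> 0"
  shows "divided_difference f X \<le> divided_difference (\<lambda>x. f (x + t)) X"
  unfolding divided_difference_translate[OF assms(3)]
  using assms by (intro divided_difference_image_mono) auto

lemma pconvex_on_Delta:
  assumes "pconvex_on (Suc p) {M<..} f"
  shows "pconvex_on p {M<..} (Delta f)"
  unfolding pconvex_on_def Delta_def divided_difference_diff
  using divided_difference_translate_mono[OF assms, of _ 1] by auto

lemma pconvex_on_Delta_pow:
  assumes "pconvex_on (p + j) {M<..} f"
  shows "pconvex_on p {M<..} ((Delta ^^ j) f)"
  using assms
proof (induction j arbitrary: p)
  case (Suc j)
  then show ?case
    using Suc.IH[of "Suc p"] by (auto intro: pconvex_on_Delta)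
qed simp

lemma pconvex_on_derivative:
  assumes f: "pconvex_on (Suc p) {M<..} f"
    and f': "\<And>x. x > M \<Longrightarrow> (f has_real_derivative f' x) (at x)"
  shows "pconvex_on p {M<..} f'"
  unfolding pconvex_on_def
proof safe
  fix X assume X: "X \<subseteq> {M<..}" "finite X" "card X = p + 2"
  have "((\<lambda>t. divided_difference (\<lambda>x. (f (x + t) - f x) / t) X) \<longlongrightarrow> divided_difference f' X) (at_right 0)"
  proof (rule tendsto_divided_difference)
    fix x assume "x \<in> X"
    then have "((\<lambda>t. (f (x + t) - f x) / t) \<longlongrightarrow> f' x) (at 0)"
      using f'[of x] X by (auto simp: DERIV_def)
    then show "((\<lambda>t. (f (x + t) - f x) / t) \<longlongrightarrow> f' x) (at_right 0)"
      by (rule tendsto_mono[rotated]) (simp add: at_le)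
  qed
  moreover have "eventually (\<lambda>t. divided_difference (\<lambda>x. (f (x + t) - f x) / t) X \<ge> 0) (at_right 0)"
  proof (rule eventually_at_rightI)
    fix t :: real assume "t \<in> {0<..<1}"
    then show "divided_difference (\<lambda>x. (f (x + t) - f x) / t) X \<ge> 0"
      using divided_difference_translate_mono[OF f X, of t]
        divided_difference_cmult[of "1 / t" "\<lambda>x. f (x + t) - f x" X]
      by (simp add: divided_difference_diff)
  qed simp
  ultimately show "divided_difference f' X \<ge> 0"
    by (rule tendsto_lowerbound) simp
qed

text \<open>Let \<open>x0\<close> be one of the nodes and contract all nodes towards \<open>x0\<close> by the factor \<open>u\<close>. The
  function \<open>\<Phi> u\<close> below, for \<open>u > 0\<close> a positive multiple of the divided difference at the contracted
  nodes, vanishes at \<open>u = 0\<close>. Its derivative is a positive multiple of the divided difference of \<open>f'\<close>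
  at the contracted nodes other than \<open>x0\<close>.\<close>

lemma pconvex_on_antiderivative:
  assumes f': "pconvex_on p {M<..} f'"
    and deriv: "\<And>x. x > M \<Longrightarrow> (f has_real_derivative f' x) (at x)"
  shows "pconvex_on (Suc p) {M<..} f"
  unfolding pconvex_on_def
proof safe
  fix X assume X: "X \<subseteq> {M<..}" "finite X" "card X = Suc p + 2"
  then obtain x0 Y where Y: "X = insert x0 Y" "x0 \<notin> Y" "finite Y" "card Y = p + 2"
    by (metis add_Suc card_Suc_eq_finite)
  define \<Phi> where "\<Phi> u = divided_difference (\<lambda>z. f (u * z + (1 - u) * x0)) X" for u
  define \<Phi>' where "\<Phi>' u = divided_difference (\<lambda>z. (z - x0) * f' (u * z + (1 - u) * x0)) X" for u
  have gtM: "u * z + (1 - u) * x0 > M" if "0 \<le> u" "u \<le> 1" "z \<in> X" for u z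
  proof -
    have "z > M" "x0 > M"
      using that X Y by auto
    then have "u * M \<le> u * z" "(1 - u) * M \<le> (1 - u) * x0" "u \<noteq> 0 \<Longrightarrow> u * M < u * z"
        "u = 0 \<Longrightarrow> (1 - u) * M < (1 - u) * x0"
      using that by (auto intro!: mult_left_mono mult_strict_left_mono)
    then show ?thesis
      by (cases "u = 0") (auto simp: algebra_simps)
  qed
  have "\<Phi> 0 \<le> \<Phi> 1"
  proof (rule DERIV_nonneg_imp_nondecreasing[of 0 1])
    fix u :: real assume u: "0 \<le> u" "u \<le> 1"
    have "(\<Phi> has_real_derivative \<Phi>' u) (at u)"
      unfolding \<Phi>_def \<Phi>'_def divided_difference_def
    proof (rule DERIV_sum)
      fix z assume "z \<in> X"
      have "((\<lambda>u. f (u * z + (1 - u) * x0)) has_real_derivative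
          f' (u * z + (1 - u) * x0) * (z - x0)) (at u)"
        by (rule DERIV_chain2[where f = f and g = "\<lambda>u. u * z + (1 - u) * x0", OF deriv[OF gtM[OF u \<open>z \<in> X\<close>]]])
           (auto intro!: derivative_eq_intros simp: algebra_simps)
      then show "((\<lambda>u. f (u * z + (1 - u) * x0) / (\<Prod>y\<in>X - {z}. z - y)) has_real_derivative
          (z - x0) * f' (u * z + (1 - u) * x0) / (\<Prod>y\<in>X - {z}. z - y)) (at u)"
        by (auto dest: DERIV_cdivide simp: mult.commute)
    qed
    moreover have "\<Phi>' u \<ge> 0"
    proof (cases "u = 0")
      case True
      then show ?thesis
        using Y by (simp add: \<Phi>'_def divided_difference_mult_root divided_difference_const)
    next
      case False
      have "divided_difference f' ((\<lambda>z. u * z + (1 - u) * x0) ` Y) \<ge> 0"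
        using f'
      proof (rule pconvex_onD)
        show "card ((\<lambda>z. u * z + (1 - u) * x0) ` Y) = p + 2"
          using False Y by (subst card_image) (auto intro: inj_onI)
      qed (use gtM[OF u] Y in auto)
      then show ?thesis
        using u False Y by (simp add: \<Phi>'_def divided_difference_mult_root divided_difference_affine)
    qed
    ultimately show "\<exists>y. (\<Phi> has_real_derivative y) (at u) \<and> 0 \<le> y" by blast
  qed simp
  moreover have "\<Phi> 0 = 0"
    using X by (simp add: \<Phi>_def divided_difference_const)
  ultimately show "divided_difference f X \<ge> 0"
    by (simp add: \<Phi>_def)
qed

lemma KsetE:
  assumes "f \<in> Kset p"
  obtains M s where "M \<ge> 0" "s = 1 \<or> s = - 1" "pconvex_on p {M<..} (\<lambda>x. s * f x)"
proof -
  from assms obtain M where "M \<ge> 0" "pconvex_on p {M<..} f \<or> pconvex_on p {M<..} (\<lambda>x. - f x)"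
    by (auto simp: Kset_def pconcave_on_def)
  then show ?thesis
    using that[of M 1] that[of M "- 1"] by auto
qed

lemma KsetI:
  assumes "M \<ge> 0" "s = 1 \<or> s = - 1" "pconvex_on p {M<..} (\<lambda>x. s * f x)"
  shows "f \<in> Kset p"
  using assms by (auto simp: Kset_def pconcave_on_def)

lemma Kset_cong_divided_difference:
  assumes "f \<in> Kset p"
    and "\<And>X. X \<subseteq> {0<..} \<Longrightarrow> finite X \<Longrightarrow> card X = p + 2 \<Longrightarrow> divided_difference g X = divided_difference f X"
  shows "g \<in> Kset p"
proof -
  obtain M s where M: "M \<ge> 0" "s = 1 \<or> s = - 1" "pconvex_on p {M<..} (\<lambda>x. s * f x)"
    using assms(1) by (rule KsetE)
  have "pconvex_on p {M<..} (\<lambda>x. s * g x)"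
    unfolding pconvex_on_def
  proof safe
    fix X assume "X \<subseteq> {M<..}" "finite X" "card X = p + 2"
    moreover from this have "X \<subseteq> {0<..}" using M(1) by force
    ultimately show "divided_difference (\<lambda>x. s * g x) X \<ge> 0"
      using pconvex_onD[OF M(3), of X] assms(2)[of X] by (simp add: divided_difference_cmult)
  qed
  with M(1,2) show ?thesis by (rule KsetI)
qed

lemma Kset_cong:
  assumes "f \<in> Kset p" "\<And>x. x > 0 \<Longrightarrow> f x = g x"
  shows "g \<in> Kset p"
  using assms(1)
  by (rule Kset_cong_divided_difference) (use assms(2) in \<open>force intro!: divided_difference_cong\<close>)

lemma Kset_add_const: "f \<in> Kset p \<Longrightarrow> (\<lambda>x. f x + c) \<in> Kset p"
  by (erule Kset_cong_divided_difference) (simp add: divided_difference_add divided_difference_const)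

text \<open>If some divided difference of order \<open>p + 1\<close> of a \<open>(p + 1)\<close>-convex function is positive, then,
  by monotonicity, all those at nodes further to the right are; otherwise, all of them are nonpositive.\<close>

lemma Kset_Suc_subset: "Kset (Suc p) \<subseteq> Kset p"
proof
  fix f assume "f \<in> Kset (Suc p)"
  then obtain M s where M: "M \<ge> 0" "s = 1 \<or> s = - 1" and conv: "pconvex_on (Suc p) {M<..} (\<lambda>x. s * f x)"
    by (rule KsetE)
  show "f \<in> Kset p"
  proof (cases "\<exists>X. X \<subseteq> {M<..} \<and> finite X \<and> card X = p + 2 \<and> divided_difference (\<lambda>x. s * f x) X > 0")
    case True
    then obtain X where X: "X \<subseteq> {M<..}" "finite X" "card X = p + 2" "divided_difference (\<lambda>x. s * f x) X > 0"
      by blast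
    have "X \<noteq> {}" using X(3) by auto
    show ?thesis
    proof (rule KsetI)
      show "Max X \<ge> 0"
        using Max_in[OF X(2) \<open>X \<noteq> {}\<close>] X(1) M(1) by fastforce
      show "pconvex_on p {Max X<..} (\<lambda>x. s * f x)"
        unfolding pconvex_on_def
      proof safe
        fix Y assume Y: "Y \<subseteq> {Max X<..}" "finite Y" "card Y = p + 2"
        then obtain h where h: "bij_betw h X Y"
          using X by (metis finite_same_card_bij)
        have le: "x \<le> h x" if "x \<in> X" for x
        proof -
          have "h x > Max X" using h that Y(1) by (auto dest: bij_betw_apply)
          then show ?thesis using Max_ge[OF X(2) that] by simp
        qed
        have "divided_difference (\<lambda>x. s * f x) X \<le> divided_difference (\<lambda>x. s * f x) (h ` X)"
          using conv X h le by (intro divided_difference_image_mono) (auto simp: bij_betw_def)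
        also have "h ` X = Y"
          using h by (simp add: bij_betw_def)
        finally show "divided_difference (\<lambda>x. s * f x) Y \<ge> 0"
          using X(4) by simp
      qed
    qed (use M in auto)
  next
    case False
    have neg: "(\<lambda>x. - s * f x) = (\<lambda>x. (- 1) * (s * f x))" by simp
    have "pconvex_on p {M<..} (\<lambda>x. - s * f x)"
      unfolding pconvex_on_def neg divided_difference_cmult
      using False by (auto simp: not_less divided_difference_cmult)
    then show ?thesis
      by (rule KsetI[rotated 2]) (use M in auto)
  qed
qed

lemma Kset_antimono: "p \<le> q \<Longrightarrow> Kset q \<subseteq> Kset p"
  by (rule lift_Suc_antimono_le[of Kset]) (rule Kset_Suc_subset)

section \<open>Newton interpolation at equidistant nodes\<close>

definition nodes :: "real \<Rightarrow> nat \<Rightarrow> real set" where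
  "nodes a p = (\<lambda>i. a + real i) ` {..<p}"

lemma finite_nodes [simp]: "finite (nodes a p)"
  by (simp add: nodes_def)

lemma card_nodes [simp]: "card (nodes a p) = p"
  unfolding nodes_def by (subst card_image) (auto intro: inj_onI)

lemma nodes_Suc: "nodes a (Suc p) = insert (a + real p) (nodes a p)"
  by (simp add: nodes_def lessThan_Suc)

lemma nodes_Suc_shift: "nodes a (Suc p) = insert a (nodes (a + 1) p)"
proof -
  have "(\<lambda>i. a + real (Suc i)) ` {..<p} = (\<lambda>i. a + 1 + real i) ` {..<p}"
    by (rule image_cong) auto
  then show ?thesis
    by (simp add: nodes_def lessThan_Suc_eq_insert_0 image_image)
qed

lemma nodes_add: "(\<lambda>x. x + t) ` nodes a p = nodes (a + t) p"
  by (simp add: nodes_def image_image add_ac)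

lemma nodes_ge: "y \<in> nodes a p \<Longrightarrow> a \<le> y"
  by (auto simp: nodes_def)

lemma divided_difference_nodes:
  "divided_difference f (nodes a (Suc p)) = (Delta ^^ p) f a / fact p"
proof (induction p arbitrary: a)
  case 0
  then show ?case by (simp add: nodes_def lessThan_Suc divided_difference_singleton)
next
  case (Suc p)
  let ?S = "nodes (a + 1) p" and ?b = "a + 1 + real p"
  have "divided_difference f (nodes a (Suc (Suc p))) =
      divided_difference f (insert a (insert ?b ?S))"
    by (simp only: nodes_Suc_shift[of a "Suc p"] nodes_Suc[of "a + 1"])
  also have "\<dots> = (divided_difference f (insert ?b ?S) - divided_difference f (insert a ?S)) / (?b - a)"
    by (rule divided_difference_insert_insert) (auto simp: nodes_def)
  also have "\<dots> = (divided_difference f (nodes (a + 1) (Suc p)) - divided_difference f (nodes a (Suc p))) / (1 + real p)"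
    by (simp add: nodes_Suc_shift[of a] nodes_Suc[of "a + 1"])
  also have "\<dots> = ((Delta ^^ p) f (a + 1) / fact p - (Delta ^^ p) f a / fact p) / (1 + real p)"
    by (simp only: Suc.IH)
  also have "\<dots> = (Delta ^^ Suc p) f a / fact (Suc p)"
    by (simp add: Delta_def field_simps)
  finally show ?case .
qed

lemma rho_Suc: "rho a (Suc p) f x = rho a p f x - (x gchoose p) * (Delta ^^ p) f a"
  by (simp add: rho_def)

text \<open>The function \<open>rho a p f\<close> is the error of Newton interpolation at the nodes \<open>a, \<dots>, a + p - 1\<close>.\<close>

lemma rho_eq_divided_difference:
  assumes "x \<notin> real ` {..<p}"
  shows "rho a p f x = (\<Prod>i<p. x - real i) * divided_difference f (insert (a + x) (nodes a p))"
  using assms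
proof (induction p)
  case 0
  then show ?case by (simp add: rho_def nodes_def divided_difference_singleton add.commute)
next
  case (Suc p)
  let ?S = "nodes a p"
  have x: "x \<notin> real ` {..<p}" "x \<noteq> real p"
    using Suc.prems by (auto simp: lessThan_Suc)
  have "divided_difference f (insert (a + x) (nodes a (Suc p))) =
      (divided_difference f (nodes a (Suc p)) - divided_difference f (insert (a + x) ?S)) / (real p - x)"
    unfolding nodes_Suc using x
    by (subst divided_difference_insert_insert) (auto simp: nodes_def)
  then have rec: "(x - real p) * divided_difference f (insert (a + x) (nodes a (Suc p))) =
      divided_difference f (insert (a + x) ?S) - (Delta ^^ p) f a / fact p"
    using x(2) by (simp add: divided_difference_nodes field_simps)
  have "(\<Prod>i<Suc p. x - real i) * divided_difference f (insert (a + x) (nodes a (Suc p))) =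
      (\<Prod>i<p. x - real i) * ((x - real p) * divided_difference f (insert (a + x) (nodes a (Suc p))))"
    by simp
  also have "\<dots> = rho a (Suc p) f x"
    unfolding rec
    by (simp add: rho_Suc Suc.IH[OF x(1)] gbinomial_prod_rev atLeast0LessThan right_diff_distrib)
  finally show ?case by simp
qed

lemma rho_of_nat_eq_0: "i < p \<Longrightarrow> rho a p f (real i) = 0"
proof (induction p)
  case (Suc p)
  show ?case
  proof (cases "i = p")
    case True
    have "rho a p f (real p) = (\<Prod>i<p. real p - real i) * divided_difference f (nodes a (Suc p))"
      by (subst rho_eq_divided_difference) (auto simp: nodes_Suc)
    also have "(\<Prod>i<p. real p - real i) = fact p"
      using gbinomial_prod_rev[of "real p" p]
      by (simp add: atLeast0LessThan field_simps flip: binomial_gbinomial)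
    finally show ?thesis
      using True by (simp add: rho_Suc divided_difference_nodes flip: binomial_gbinomial)
  next
    case False
    then show ?thesis
      using Suc by (simp add: rho_Suc flip: binomial_gbinomial)
  qed
qed simp

lemma Delta_pow_cmult: "(Delta ^^ j) (\<lambda>x. c * f x) = (\<lambda>x. c * (Delta ^^ j) f x)"
  by (induction j) (simp_all add: Delta_def fun_eq_iff right_diff_distrib)

lemma rho_cmult: "rho a p (\<lambda>x. c * f x) x = c * rho a p f x"
  by (simp add: rho_def Delta_pow_cmult sum_distrib_left right_diff_distrib mult.left_commute)

lemma Delta_pow_mono:
  assumes "pconvex_on p {M<..} f" "a > M" "t \<ge> 0"
  shows "(Delta ^^ p) f a \<le> (Delta ^^ p) f (a + t)"
proof -
  have "divided_difference f (nodes a (Suc p)) \<le>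
      divided_difference f ((\<lambda>y. y + t) ` nodes a (Suc p))"
    using assms(1)
  proof (rule divided_difference_image_mono)
    show "nodes a (Suc p) \<subseteq> {M<..}"
      using assms(2) by (fastforce dest: nodes_ge)
  qed (use assms(3) in auto)
  then show ?thesis
    by (simp add: nodes_add divided_difference_nodes divide_le_cancel)
qed

text \<open>The factor \<open>x\<close> of the Newton error, multiplied by its divided difference of order \<open>p + 1\<close>,
  gives a difference of two divided differences of order \<open>p\<close>. By monotonicity these lie between
  the ones at the nodes \<open>a, \<dots>, a + p\<close> and at the same nodes shifted by \<open>N\<close>.\<close>

lemma abs_rho_le_pconvex:
  assumes f: "pconvex_on p {M<..} f" and a: "a > M" and x: "0 < x" "x \<le> real N"
  shows "\<bar>rho a (Suc p) f x\<bar> \<le> \<bar>(x - 1) gchoose p\<bar> * ((Delta ^^ p) f (a + real N) - (Delta ^^ p) f a)"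
proof -
  have nodesM: "nodes a q \<subseteq> {M<..}" "nodes (a + 1) q \<subseteq> {M<..}" for q
    using a by (fastforce dest: nodes_ge)+
  show ?thesis
  proof (cases "x \<in> real ` {..<Suc p}")
    case True
    then have "rho a (Suc p) f x = 0"
      by (auto simp: rho_of_nat_eq_0)
    then show ?thesis
      using Delta_pow_mono[OF f a, of "real N"] by simp
  next
    case False
    define T where "T = nodes (a + 1) p"
    have T: "a \<notin> T" "a + x \<notin> T" "finite T"
    proof -
      show "a + x \<notin> T"
      proof
        assume "a + x \<in> T"
        then obtain i where "i < p" "x = real (Suc i)" by (auto simp: T_def nodes_def)
        then show False using False by blast
      qed
    qed (auto simp: T_def dest: nodes_ge)
    define D where "D = divided_difference f (insert (a + x) (nodes a (Suc p)))"
    have "D = divided_difference f (insert a (insert (a + x) T))"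
      by (simp only: D_def T_def nodes_Suc_shift insert_commute)
    also have "\<dots> = (divided_difference f (insert (a + x) T) - divided_difference f (insert a T)) / x"
      using T x by (subst divided_difference_insert_insert) auto
    finally have xD: "x * D = divided_difference f (insert (a + x) T) - (Delta ^^ p) f a / fact p"
      using x by (simp add: T_def flip: nodes_Suc_shift divided_difference_nodes)
    have "D \<ge> 0"
      unfolding D_def
    proof (rule pconvex_onD[OF f])
      have "a + x \<notin> nodes a (Suc p)"
        using False by (auto simp: nodes_def)
      then show "card (insert (a + x) (nodes a (Suc p))) = p + 2" by simp
    qed (use nodesM a x in auto)
    \<comment> \<open>As \<open>x \<le> N\<close>, this moves all nodes to the right; \<open>a + N\<close>, the only node of the shifted set
      that is not a shift of an element of \<open>T\<close>, is reached from \<open>a + x\<close>.\<close>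
    define h where "h y = (if y = a + x then a + real N else y + real N)" for y
    have hT: "h ` T = (\<lambda>y. y + real N) ` T"
      using T(2) by (intro image_cong) (auto simp: h_def)
    have "divided_difference f (insert (a + x) T) \<le> divided_difference f (h ` insert (a + x) T)"
      using f
    proof (rule divided_difference_image_mono)
      show "inj_on h (insert (a + x) T)"
        using T by (auto simp: inj_on_def h_def)
      show "card (insert (a + x) T) = p + 1"
        using T by (simp add: T_def)
    qed (use T x a nodesM in \<open>auto simp: h_def T_def\<close>)
    also have "h ` insert (a + x) T = nodes (a + real N) (Suc p)"
      by (simp add: hT nodes_Suc_shift) (simp add: h_def T_def nodes_add add.commute add.left_commute)
    finally have "x * D \<le> ((Delta ^^ p) f (a + real N) - (Delta ^^ p) f a) / fact p"
      by (simp add: xD divided_difference_nodes diff_divide_distrib)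
    then have le: "fact p * (x * D) \<le> (Delta ^^ p) f (a + real N) - (Delta ^^ p) f a"
      by (simp add: field_simps)
    have "rho a (Suc p) f x = (\<Prod>i<Suc p. x - real i) * D"
      using False by (simp add: D_def rho_eq_divided_difference)
    also have "(\<Prod>i<Suc p. x - real i) = x * (\<Prod>i<p. x - 1 - real i)"
      by (subst prod.lessThan_Suc_shift) (simp add: algebra_simps)
    also have "(\<Prod>i<p. x - 1 - real i) = fact p * ((x - 1) gchoose p)"
      by (simp add: gbinomial_prod_rev atLeast0LessThan)
    finally have "\<bar>rho a (Suc p) f x\<bar> = \<bar>(x - 1) gchoose p\<bar> * (fact p * (x * D))"
      using x \<open>D \<ge> 0\<close> by (simp add: abs_mult)
    also have "\<dots> \<le> \<bar>(x - 1) gchoose p\<bar> * ((Delta ^^ p) f (a + real N) - (Delta ^^ p) f a)"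
      using le by (intro mult_left_mono) auto
    finally show ?thesis .
  qed
qed

lemma abs_rho_le:
  assumes "f \<in> Kset p"
  obtains M where "\<And>a x N. M < a \<Longrightarrow> 0 < x \<Longrightarrow> x \<le> real N \<Longrightarrow>
    \<bar>rho a (Suc p) f x\<bar> \<le> \<bar>(x - 1) gchoose p\<bar> * \<bar>(Delta ^^ p) f (a + real N) - (Delta ^^ p) f a\<bar>"
proof -
  obtain M s where M: "M \<ge> 0" "s = 1 \<or> s = - 1" "pconvex_on p {M<..} (\<lambda>x. s * f x)"
    using assms by (rule KsetE)
  have "\<bar>rho a (Suc p) f x\<bar> \<le> \<bar>(x - 1) gchoose p\<bar> * \<bar>(Delta ^^ p) f (a + real N) - (Delta ^^ p) f a\<bar>"
    if "M < a" "0 < x" "x \<le> real N" for a x N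
  proof -
    have "\<bar>s * rho a (Suc p) f x\<bar> \<le> \<bar>(x - 1) gchoose p\<bar> * (s * ((Delta ^^ p) f (a + real N) - (Delta ^^ p) f a))"
      using abs_rho_le_pconvex[OF M(3) that] by (simp only: rho_cmult Delta_pow_cmult right_diff_distrib)
    also have "\<dots> \<le> \<bar>(x - 1) gchoose p\<bar> * \<bar>(Delta ^^ p) f (a + real N) - (Delta ^^ p) f a\<bar>"
      using M(2) by (intro mult_left_mono) auto
    finally show ?thesis
      using M(2) by (auto simp: abs_mult)
  qed
  then show ?thesis by (rule that)
qed

lemma Delta_pow_cong:
  assumes "\<And>x. x > 0 \<Longrightarrow> f x = g x" "x > 0"
  shows "(Delta ^^ j) f x = (Delta ^^ j) g x"
  using assms(2) by (induction j arbitrary: x) (simp_all add: Delta_def assms(1))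

lemma Delta_pow_Suc_eq:
  assumes "\<And>x. x > 0 \<Longrightarrow> Delta F x = g x" "x > 0"
  shows "(Delta ^^ Suc j) F x = (Delta ^^ j) g x"
  unfolding funpow_Suc_right comp_def using assms by (rule Delta_pow_cong)

lemma Dset_cong:
  assumes "f \<in> Dset p" "\<And>x. x > 0 \<Longrightarrow> f x = g x"
  shows "g \<in> Dset p"
proof -
  have "eventually (\<lambda>n. (Delta ^^ p) f (real n) = (Delta ^^ p) g (real n)) sequentially"
    using eventually_gt_at_top[of 0] by eventually_elim (rule Delta_pow_cong, use assms(2) in auto)
  then show ?thesis
    using assms(1) unfolding Dset_def mem_Collect_eq by (rule Lim_transform_eventually[rotated])
qed

lemma DsetD: "f \<in> Dset p \<Longrightarrow> (\<lambda>n. (Delta ^^ p) f (real n)) \<longlonglongrightarrow> 0"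
  by (simp add: Dset_def)

lemma Dset_shiftD: "f \<in> Dset p \<Longrightarrow> (\<lambda>n. (Delta ^^ p) f (real n + real k)) \<longlonglongrightarrow> 0"
  using LIMSEQ_ignore_initial_segment[OF DsetD, of f p k] by simp

lemma Dset_Suc_subset: "Dset p \<subseteq> Dset (Suc p)"
proof
  fix f assume f: "f \<in> Dset p"
  show "f \<in> Dset (Suc p)"
    using tendsto_diff[OF Dset_shiftD[OF f, of 1] DsetD[OF f]] by (simp add: Dset_def Delta_def)
qed

lemma Dset_mono: "p \<le> q \<Longrightarrow> Dset p \<subseteq> Dset q"
  by (rule lift_Suc_mono_le[of Dset]) (rule Dset_Suc_subset)

lemma Dset_cmult: "f \<in> Dset p \<Longrightarrow> (\<lambda>x. c * f x) \<in> Dset p"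
  by (auto simp: Dset_def Delta_pow_cmult intro: tendsto_mult_right_zero)

lemma Dset_Suc_Delta:
  assumes "\<And>x. x > 0 \<Longrightarrow> Delta F x = g x" "g \<in> Dset p"
  shows "F \<in> Dset (Suc p)"
proof -
  have "Delta F \<in> Dset p"
    using assms(2) by (rule Dset_cong) (simp add: assms(1))
  then show ?thesis
    by (simp only: Dset_def mem_Collect_eq funpow_Suc_right comp_def)
qed

lemma eventually_real_gt: "eventually (\<lambda>n. M < real n) sequentially"
  using filterlim_real_sequentially by (simp add: filterlim_at_top_dense)

text \<open>Since \<open>(Delta ^^ p) f\<close> has vanishing increments along the integers, the bound of \<open>abs_rho_le\<close>,
  whose shift \<open>N\<close> depends on \<open>x\<close> only, tends to 0.\<close>

lemma rho_tendsto_0: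
  assumes f: "f \<in> Kset p" "f \<in> Dset (Suc p)" and x: "x > 0"
  shows "(\<lambda>n. rho (real n) (Suc p) f x) \<longlonglongrightarrow> 0"
proof -
  obtain M where M: "\<And>a x N. M < a \<Longrightarrow> 0 < x \<Longrightarrow> x \<le> real N \<Longrightarrow>
    \<bar>rho a (Suc p) f x\<bar> \<le> \<bar>(x - 1) gchoose p\<bar> * \<bar>(Delta ^^ p) f (a + real N) - (Delta ^^ p) f a\<bar>"
    by (rule abs_rho_le[OF f(1)], rule that)
  obtain N where N: "x \<le> real N"
    using real_arch_simple by blast
  have tele: "(Delta ^^ p) f (a + real N) - (Delta ^^ p) f a = (\<Sum>l<N. (Delta ^^ Suc p) f (a + real l))" for a
    using sum_lessThan_telescope[of "\<lambda>l. (Delta ^^ p) f (a + real l)" N]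
    by (simp add: Delta_def add.commute add.left_commute)
  have lim: "(\<lambda>n. (Delta ^^ p) f (real n + real N) - (Delta ^^ p) f (real n)) \<longlonglongrightarrow> 0"
    unfolding tele by (intro tendsto_null_sum Dset_shiftD f)
  show ?thesis
  proof (rule Lim_null_comparison)
    show "eventually (\<lambda>n. norm (rho (real n) (Suc p) f x) \<le>
       \<bar>(x - 1) gchoose p\<bar> * \<bar>(Delta ^^ p) f (real n + real N) - (Delta ^^ p) f (real n)\<bar>) sequentially"
      using eventually_real_gt[of M]
      by eventually_elim (use M x N in auto)
    show "(\<lambda>n. \<bar>(x - 1) gchoose p\<bar> * \<bar>(Delta ^^ p) f (real n + real N) - (Delta ^^ p) f (real n)\<bar>) \<longlonglongrightarrow> 0"
      using lim by (intro tendsto_mult_right_zero tendsto_rabs_zero)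
  qed
qed

section \<open>The difference equation\<close>

text \<open>Two solutions differ by a function of period 1. By Newton interpolation, \<open>F (x + n)\<close> is up to
  a vanishing error determined by \<open>F n\<close> and the values \<open>(Delta ^^ j) g n\<close>, hence the same for both.\<close>

lemma difference_equation_unique:
  assumes g: "g \<in> Dset p"
    and F: "F \<in> Kset p" "\<And>x. x > 0 \<Longrightarrow> Delta F x = g x"
    and G: "G \<in> Kset p" "\<And>x. x > 0 \<Longrightarrow> Delta G x = g x"
    and 1: "F 1 = G 1" and x: "x > 0"
  shows "F x = G x"
proof -
  have step: "F (y + real n) - G (y + real n) = F y - G y" if "y > 0" for y n
  proof (induction n)
    case (Suc n)
    have "F (y + real n + 1) - F (y + real n) = G (y + real n + 1) - G (y + real n)"
      using F(2)[of "y + real n"] G(2)[of "y + real n"] that by (simp add: Delta_def)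
    then show ?case using Suc.IH by (simp add: add_ac)
  qed simp
  have "F x - G x = rho (real n) (Suc p) F x - rho (real n) (Suc p) G x" if "n \<ge> 1" for n
  proof -
    have "(Delta ^^ j) F (real n) = (Delta ^^ j) G (real n)" for j
    proof (cases j)
      case 0
      then show ?thesis
        using step[of 1 "n - 1"] 1 that by (simp add: of_nat_diff)
    next
      case (Suc i)
      then show ?thesis
        using Delta_pow_Suc_eq[OF F(2), of "real n" i] Delta_pow_Suc_eq[OF G(2), of "real n" i] that by simp
    qed
    then show ?thesis
      using step[OF x, of n] by (simp add: rho_def del: sum.lessThan_Suc)
  qed
  then have "eventually (\<lambda>n. rho (real n) (Suc p) F x - rho (real n) (Suc p) G x = F x - G x) sequentially"
    by (intro eventually_mono[OF eventually_ge_at_top[of 1]]) auto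
  moreover have "(\<lambda>n. rho (real n) (Suc p) F x - rho (real n) (Suc p) G x) \<longlonglongrightarrow> 0 - 0"
    using F G g x by (intro tendsto_diff rho_tendsto_0) (auto intro: Dset_Suc_Delta)
  ultimately have "(\<lambda>n. F x - G x) \<longlonglongrightarrow> 0 - 0"
    by (rule Lim_transform_eventually[rotated])
  then show ?thesis
    by (simp add: LIMSEQ_const_iff)
qed

lemma summable_shift_diff:
  fixes u :: "nat \<Rightarrow> real"
  assumes "u \<longlonglongrightarrow> l"
  shows "summable (\<lambda>i. u (i + N) - u i)"
proof (induction N)
  case (Suc N)
  have "(\<lambda>i. u (i + N)) \<longlonglongrightarrow> l"
    using assms by (rule LIMSEQ_ignore_initial_segment)
  then have "summable (\<lambda>i. u (Suc i + N) - u (i + N))"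
    by (rule telescope_summable)
  from summable_add[OF this Suc.IH] show ?case by simp
qed simp

text \<open>The \<open>n\<close>-th term of the limit formula for \<open>\<Sigma>g\<close>, where \<open>n = i + 1\<close>.\<close>

definition Sigma_approx :: "nat \<Rightarrow> (real \<Rightarrow> real) \<Rightarrow> nat \<Rightarrow> real \<Rightarrow> real" where
  "Sigma_approx p g i x = (\<Sum>k<i. g (real k + 1)) - (\<Sum>k<Suc i. g (x + real k))
     + (\<Sum>j<p. (Delta ^^ j) g (real i + 1) * (x gchoose Suc j))"

lemma Sigma_approx_Suc:
  "Sigma_approx p g (Suc i) x - Sigma_approx p g i x = - rho (real i + 1) (Suc p) g x"
proof -
  have "rho (real i + 1) (Suc p) g x =
      g (x + real i + 1) - g (real i + 1) - (\<Sum>j<p. (Delta ^^ Suc j) g (real i + 1) * (x gchoose Suc j))"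
    unfolding rho_def sum.lessThan_Suc_shift by (simp add: add.assoc mult.commute)
  also have "(\<Sum>j<p. (Delta ^^ Suc j) g (real i + 1) * (x gchoose Suc j)) =
      (\<Sum>j<p. (Delta ^^ j) g (real (Suc i) + 1) * (x gchoose Suc j))
      - (\<Sum>j<p. (Delta ^^ j) g (real i + 1) * (x gchoose Suc j))"
    by (simp add: Delta_def add.commute add.left_commute left_diff_distrib sum_subtractf)
  finally show ?thesis
    by (simp add: Sigma_approx_def add_ac)
qed

lemma Delta_Sigma_approx:
  "Sigma_approx p g i (x + 1) - Sigma_approx p g i x = g x - rho (real i + 1) p g x"
proof -
  have tele: "(\<Sum>k<Suc i. g (x + 1 + real k)) - (\<Sum>k<Suc i. g (x + real k)) = g (x + (real i + 1)) - g x"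
    using sum_lessThan_telescope[of "\<lambda>k. g (x + real k)" "Suc i"]
    by (simp add: sum_subtractf add_ac del: sum.lessThan_Suc)
  have "(\<Sum>j<p. (Delta ^^ j) g (real i + 1) * ((x + 1) gchoose Suc j))
      - (\<Sum>j<p. (Delta ^^ j) g (real i + 1) * (x gchoose Suc j))
      = (\<Sum>j<p. (x gchoose j) * (Delta ^^ j) g (real i + 1))"
    unfolding gbinomial_Suc_Suc by (simp add: algebra_simps sum.distrib)
  with tele show ?thesis
    unfolding Sigma_approx_def rho_def by linarith
qed

text \<open>Up to a polynomial of degree at most \<open>p\<close>, the function is a sum of translates of \<open>g\<close>.\<close>

lemma pconvex_on_neg_Sigma_approx:
  assumes "pconvex_on p {M<..} g"
  shows "pconvex_on p {M<..} (\<lambda>x. - Sigma_approx p g i x)"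
  unfolding pconvex_on_def
proof safe
  fix X assume X: "X \<subseteq> {M<..}" "finite X" "card X = p + 2"
  have "- Sigma_approx p g i x = (\<Sum>k<Suc i. g (x + real k)) - (\<Sum>k<i. g (real k + 1))
     - (\<Sum>j<p. (Delta ^^ j) g (real i + 1) * ((x + 0) gchoose Suc j))" for x
    by (simp add: Sigma_approx_def)
  then have "divided_difference (\<lambda>x. - Sigma_approx p g i x) X =
      (\<Sum>k<Suc i. divided_difference (\<lambda>x. g (x + real k)) X)
      - divided_difference (\<lambda>x. \<Sum>k<i. g (real k + 1)) X
      - (\<Sum>j<p. (Delta ^^ j) g (real i + 1) * divided_difference (\<lambda>x. (x + 0) gchoose Suc j) X)"
    by (simp only: divided_difference_diff divided_difference_sum[symmetric] divided_difference_cmult[symmetric])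
  also have "\<dots> = (\<Sum>k<Suc i. divided_difference (\<lambda>x. g (x + real k)) X)"
    using X divided_difference_gchoose[OF X(2), of "Suc _" 0] by (simp add: divided_difference_const)
  also have "\<dots> \<ge> 0"
  proof (rule sum_nonneg)
    fix k
    show "divided_difference (\<lambda>x. g (x + real k)) X \<ge> 0"
      unfolding divided_difference_translate[OF X(2)] using assms
    proof (rule pconvex_onD)
      show "(\<lambda>x. x + real k) ` X \<subseteq> {M<..}"
        using X(1) by fastforce
    qed (use X in \<open>auto simp: card_image\<close>)
  qed
  finally show "divided_difference (\<lambda>x. - Sigma_approx p g i x) X \<ge> 0" .
qed

lemma continuous_on_gchoose [continuous_intros]:
  fixes f :: "'a::topological_space \<Rightarrow> real"
  shows "continuous_on A f \<Longrightarrow> continuous_on A (\<lambda>x. f x gchoose j)"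
  unfolding gbinomial_prod_rev by (intro continuous_intros) auto

text \<open>Consecutive approximants differ by a Newton error. Its bound is an increment of
  \<open>(Delta ^^ p) g\<close> times a factor that is bounded in \<open>x\<close>, and these increments telescope.\<close>

lemma uniform_limit_Sigma_approx:
  assumes conv: "pconvex_on p {M<..} g" and g: "g \<in> Dset p"
  obtains F where "\<And>N. uniform_limit {0<..<real N} (Sigma_approx p g) F sequentially"
proof
  fix N :: nat
  define d where "d i x = - rho (real i + 1) (Suc p) g x" for i x
  have "compact ((\<lambda>x. (x - 1) gchoose p) ` {0..real N})"
    by (intro compact_continuous_image continuous_intros) auto
  then obtain C where C: "\<And>x. x \<in> {0..real N} \<Longrightarrow> \<bar>(x - 1) gchoose p\<bar> \<le> C"
    by (force dest!: compact_imp_bounded simp: bounded_iff)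
  define u where "u i = (Delta ^^ p) g (real i + 1)" for i
  have "summable (\<lambda>i. u (i + N) - u i)"
    using Dset_shiftD[OF g, of 1] by (intro summable_shift_diff) (simp add: u_def)
  then have "summable (\<lambda>i. C * (u (i + N) - u i))"
    by (rule summable_mult)
  moreover have "eventually (\<lambda>i. \<forall>x\<in>{0<..<real N}. norm (d i x) \<le> C * (u (i + N) - u i)) sequentially"
    using eventually_real_gt[of M]
  proof eventually_elim
    case (elim i)
    show ?case
    proof
      fix x assume x: "x \<in> {0<..<real N}"
      have le: "\<bar>d i x\<bar> \<le> \<bar>(x - 1) gchoose p\<bar> * (u (i + N) - u i)"
        using abs_rho_le_pconvex[OF conv, of "real i + 1" x N] elim x
        by (simp add: d_def u_def add_ac)
      have "u (i + N) - u i \<ge> 0"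
        using Delta_pow_mono[OF conv, of "real i + 1" "real N"] elim by (simp add: u_def add_ac)
      then have "\<bar>(x - 1) gchoose p\<bar> * (u (i + N) - u i) \<le> C * (u (i + N) - u i)"
        using C[of x] x by (intro mult_right_mono) auto
      with le show "norm (d i x) \<le> C * (u (i + N) - u i)" by simp
    qed
  qed
  ultimately have "uniform_limit {0<..<real N} (\<lambda>n x. \<Sum>i<n. d i x) (\<lambda>x. suminf (\<lambda>i. d i x)) sequentially"
    by (intro Weierstrass_m_test_ev)
  then have "uniform_limit {0<..<real N} (\<lambda>n x. Sigma_approx p g 0 x + (\<Sum>i<n. d i x))
      (\<lambda>x. Sigma_approx p g 0 x + suminf (\<lambda>i. d i x)) sequentially"
    by (intro uniform_limit_intros)
  moreover have "Sigma_approx p g 0 x + (\<Sum>i<n. d i x) = Sigma_approx p g n x" for n x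
    using sum_lessThan_telescope[of "\<lambda>i. Sigma_approx p g i x" n]
    by (simp add: d_def flip: Sigma_approx_Suc)
  ultimately show "uniform_limit {0<..<real N} (Sigma_approx p g)
      (\<lambda>x. Sigma_approx p g 0 x + suminf (\<lambda>i. - rho (real i + 1) (Suc p) g x)) sequentially"
    by (simp add: d_def fun_eq_iff)
qed

text \<open>The limit inherits \<open>p\<close>-concavity and continuity from the approximants, whose differences
  miss \<open>g\<close> only by a Newton error. Subtracting the value at 1 normalizes it.\<close>

lemma difference_equation_solvable_pconvex:
  assumes conv: "pconvex_on p {M<..} g" and M: "M \<ge> 0" and g: "g \<in> Dset p"
  obtains F where "F \<in> Kset p" "\<And>x. x > 0 \<Longrightarrow> Delta F x = g x" "F 1 = 0"
    "continuous_on {0<..} g \<Longrightarrow> continuous_on {0<..} F"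
proof -
  obtain F where unif: "\<And>N. uniform_limit {0<..<real N} (Sigma_approx p g) F sequentially"
    by (rule uniform_limit_Sigma_approx[OF conv g], rule that)
  have lim: "(\<lambda>i. Sigma_approx p g i x) \<longlonglongrightarrow> F x" if x: "x > 0" for x
  proof -
    obtain N where "x < real N" using reals_Archimedean2 by blast
    then show ?thesis
      using tendsto_uniform_limitI[OF unif, of x N] x by simp
  qed
  have Delta: "Delta F x = g x" if x: "x > 0" for x
  proof -
    have K: "g \<in> Kset p"
      using M conv by (auto simp: Kset_def)
    have "(\<lambda>n. rho (real n) (Suc p) g x + (x gchoose p) * (Delta ^^ p) g (real n)) \<longlonglongrightarrow> 0 + (x gchoose p) * 0"
      using K g x Dset_Suc_subset by (intro tendsto_intros rho_tendsto_0 DsetD) auto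
    then have "(\<lambda>n. rho (real n) p g x) \<longlonglongrightarrow> 0"
      by (simp add: rho_Suc)
    then have "(\<lambda>i. rho (real i + 1) p g x) \<longlonglongrightarrow> 0"
      by (drule_tac LIMSEQ_ignore_initial_segment[of _ _ 1]) (simp add: add.commute)
    then have "(\<lambda>i. g x - rho (real i + 1) p g x) \<longlonglongrightarrow> g x - 0"
      by (intro tendsto_intros)
    moreover have "(\<lambda>i. Sigma_approx p g i (x + 1) - Sigma_approx p g i x) \<longlonglongrightarrow> Delta F x"
      unfolding Delta_def using x by (intro tendsto_diff lim) auto
    ultimately show ?thesis
      unfolding Delta_Sigma_approx using LIMSEQ_unique by fastforce
  qed
  have "pconvex_on p {M<..} (\<lambda>x. - F x)"
    unfolding pconvex_on_def
  proof safe
    fix X assume X: "X \<subseteq> {M<..}" "finite X" "card X = p + 2"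
    have "(\<lambda>i. divided_difference (\<lambda>x. - Sigma_approx p g i x) X) \<longlonglongrightarrow> divided_difference (\<lambda>x. - F x) X"
      using X(1) M by (intro tendsto_divided_difference tendsto_minus lim) auto
    then show "divided_difference (\<lambda>x. - F x) X \<ge> 0"
      by (rule LIMSEQ_le_const)
         (use X in \<open>auto intro!: pconvex_onD[OF pconvex_on_neg_Sigma_approx[OF conv]]\<close>)
  qed
  then have "F \<in> Kset p"
    using M by (auto simp: Kset_def pconcave_on_def)
  then have K: "(\<lambda>x. F x - F 1) \<in> Kset p"
    using Kset_add_const[of F p "- F 1"] by simp
  have cont: "continuous_on {0<..} (\<lambda>x. F x - F 1)" if cont_g: "continuous_on {0<..} g"
  proof -
    have "continuous_on {0<..<real N} (Sigma_approx p g i)" for N i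
      unfolding Sigma_approx_def
      by (intro continuous_intros continuous_on_compose2[OF cont_g]) auto
    then have on: "continuous_on {0<..<real N} F" for N
      using unif by (intro uniform_limit_theorem[of _ "Sigma_approx p g" sequentially]) auto
    have "isCont F x" if "x > 0" for x
    proof -
      obtain N where "x < real N" using reals_Archimedean2 by blast
      then show ?thesis
        using on[of N] that by (simp add: continuous_on_eq_continuous_at)
    qed
    then show ?thesis
      by (intro continuous_intros) (simp add: continuous_on_eq_continuous_at)
  qed
  show ?thesis
    by (rule that[of "\<lambda>x. F x - F 1"]) (use K cont Delta in \<open>auto simp: Delta_def\<close>)
qed

lemma difference_equation_solvable:
  assumes "g \<in> Kset p" "g \<in> Dset p"
  obtains F where "F \<in> Kset p" "\<And>x. x > 0 \<Longrightarrow> Delta F x = g x" "F 1 = 0"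
    "continuous_on {0<..} g \<Longrightarrow> continuous_on {0<..} F"
proof -
  obtain M s where M: "M \<ge> 0" "s = 1 \<or> s = - 1" "pconvex_on p {M<..} (\<lambda>x. s * g x)"
    using assms(1) by (rule KsetE)
  obtain F where F: "F \<in> Kset p" "\<And>x. x > 0 \<Longrightarrow> Delta F x = s * g x" "F 1 = 0"
    "continuous_on {0<..} (\<lambda>x. s * g x) \<Longrightarrow> continuous_on {0<..} F"
    by (rule difference_equation_solvable_pconvex[OF M(3,1) Dset_cmult[OF assms(2)]], rule that)
  have "(\<lambda>x. s * F x) \<in> Kset p"
  proof -
    obtain M' s' where M': "M' \<ge> 0" "s' = 1 \<or> s' = - 1" "pconvex_on p {M'<..} (\<lambda>x. s' * F x)"
      using F(1) by (rule KsetE)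
    show ?thesis
      by (rule KsetI[of M' "s * s'"]) (use M M' in auto)
  qed
  moreover have "Delta (\<lambda>x. s * F x) x = g x" if "x > 0" for x
    using F(2)[OF that] M(2) by (auto simp: Delta_def)
  moreover have "continuous_on {0<..} (\<lambda>x. s * F x)" if "continuous_on {0<..} g"
    by (intro continuous_intros F(4) that)
  ultimately show ?thesis
    using F(3) by (intro that[of "\<lambda>x. s * F x"]) auto
qed

section \<open>The operator \<open>\<Sigma>\<close>\<close>

text \<open>The definition of \<open>Sigma_op\<close> lets every solution come with its own order; the smaller one of
  two orders is admissible for both solutions.\<close>

lemma difference_equation_unique_extensional:
  assumes "g \<in> Dset p \<inter> Kset p" "F \<in> Kset p" "g \<in> Dset q \<inter> Kset q" "G \<in> Kset q"
    and F: "F \<in> extensional {0<..}" "\<And>x. x > 0 \<Longrightarrow> Delta F x = g x" "F 1 = 0"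
    and G: "G \<in> extensional {0<..}" "\<And>x. x > 0 \<Longrightarrow> Delta G x = g x" "G 1 = 0"
  shows "F = G"
proof (rule extensionalityI[OF F(1) G(1)])
  fix x :: real assume "x \<in> {0<..}"
  moreover have "F \<in> Kset (min p q)" "G \<in> Kset (min p q)" "g \<in> Dset (min p q)"
    using assms(1-4) Kset_antimono[of "min p q" p] Kset_antimono[of "min p q" q] by (auto simp: min_def)
  ultimately show "F x = G x"
    using difference_equation_unique[of g "min p q" F G x] F G by simp
qed

lemma Sigma_op_solution:
  assumes "g \<in> Dset p" "g \<in> Kset p"
  shows "Sigma_op g \<in> Kset p \<and> (\<forall>x>0. Delta (Sigma_op g) x = g x) \<and> Sigma_op g 1 = 0 \<and>
    (continuous_on {0<..} g \<longrightarrow> continuous_on {0<..} (Sigma_op g))"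
proof -
  obtain F where F: "F \<in> Kset p" "\<And>x. x > 0 \<Longrightarrow> Delta F x = g x" "F 1 = 0"
    "continuous_on {0<..} g \<Longrightarrow> continuous_on {0<..} F"
    by (rule difference_equation_solvable[OF assms(2,1)], rule that)
  define H where "H = restrict F {0<..}"
  have HF: "F x = H x" if "x > 0" for x
    using that by (simp add: H_def)
  have "H \<in> Kset p"
    using F(1) HF by (rule Kset_cong)
  moreover have "Delta H x = g x" if "x > 0" for x
    using F(2)[OF that] that by (simp add: H_def Delta_def)
  moreover have "H 1 = 0" "H \<in> extensional {0<..}"
    using F(3) by (simp_all add: H_def)
  ultimately have H: "H \<in> Kset p" "\<And>x. x > 0 \<Longrightarrow> Delta H x = g x" "H 1 = 0" "H \<in> extensional {0<..}"
    by blast+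
  have "Sigma_op g = H"
    unfolding Sigma_op_def
  proof (rule the_equality)
    show "H \<in> extensional {0<..} \<and> (\<forall>x>0. Delta H x = g x) \<and> H 1 = 0 \<and>
        (\<exists>p. g \<in> Dset p \<inter> Kset p \<and> H \<in> Kset p)"
      using H assms by blast
  next
    fix G assume "G \<in> extensional {0<..} \<and> (\<forall>x>0. Delta G x = g x) \<and> G 1 = 0 \<and>
        (\<exists>p. g \<in> Dset p \<inter> Kset p \<and> G \<in> Kset p)"
    then show "G = H"
      using difference_equation_unique_extensional[of g _ G p H] assms H by auto
  qed
  moreover have "continuous_on {0<..} H" if "continuous_on {0<..} g"
    using F(4)[OF that] by (rule continuous_on_eq) (simp add: HF)
  ultimately show ?thesis
    using H by blast
qed

lemma
  assumes "g \<in> Dset p" "g \<in> Kset q" "p \<le> q"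
  shows Sigma_op_Kset: "Sigma_op g \<in> Kset q"
    and Delta_Sigma_op: "\<And>x. x > 0 \<Longrightarrow> Delta (Sigma_op g) x = g x"
    and continuous_on_Sigma_op: "continuous_on {0<..} g \<Longrightarrow> continuous_on {0<..} (Sigma_op g)"
    and Sigma_op_Dset: "Sigma_op g \<in> Dset (Suc p)"
proof -
  have "g \<in> Dset q" using assms Dset_mono by blast
  note sol = Sigma_op_solution[OF this assms(2)]
  show "Sigma_op g \<in> Kset q" "\<And>x. x > 0 \<Longrightarrow> Delta (Sigma_op g) x = g x"
    "continuous_on {0<..} g \<Longrightarrow> continuous_on {0<..} (Sigma_op g)"
    using sol by auto
  show "Sigma_op g \<in> Dset (Suc p)"
    by (rule Dset_Suc_Delta[of _ g]) (use sol assms in auto)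
qed

lemma Sigma_op_eqI:
  assumes "g \<in> Dset p" "g \<in> Kset p" "F \<in> Kset p" "\<And>x. x > 0 \<Longrightarrow> Delta F x = g x" "F 1 = 0" "x > 0"
  shows "Sigma_op g x = F x"
  by (rule difference_equation_unique[of g p]) (use Sigma_op_solution[OF assms(1,2)] assms in auto)

text \<open>Each application of \<open>\<Sigma>\<close> uses up one order in the scale of the \<open>Dset\<close> and preserves \<open>Kset q\<close>, so
  that it can be repeated as long as the former does not exceed \<open>q\<close>.\<close>

lemma Sigma_op_pow_Dset_Kset:
  assumes "f \<in> Dset p" "f \<in> Kset q" "p + k \<le> Suc q"
  shows "(Sigma_op ^^ k) f \<in> Dset (p + k) \<inter> Kset q"
  using assms(3)
proof (induction k)
  case (Suc k)
  then show ?case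
    using Sigma_op_Kset[of _ "p + k" q] Sigma_op_Dset[of _ "p + k" q] by simp
qed (use assms in simp)

lemma mem_dom_Sigma_pow:
  assumes "f \<in> Dset p" "f \<in> Kset q" "p + k \<le> Suc q"
  shows "f \<in> dom_Sigma_pow k"
  using assms(3)
proof (induction k)
  case (Suc k)
  then have "(Sigma_op ^^ k) f \<in> Dset q \<inter> Kset q"
    using Sigma_op_pow_Dset_Kset[OF assms(1,2), of k] Dset_mono[of "p + k" q] by auto
  then show ?case
    using Suc by (auto simp: dom_Sigma_def)
qed simp

section \<open>Derivatives\<close>

lemma Cset_0: "f \<in> Cset 0 \<longleftrightarrow> continuous_on {0<..} f"
  by (simp add: Cset_def)

lemma Cset_Suc: "f \<in> Cset (Suc r) \<longleftrightarrow> (\<forall>x>0. f differentiable at x) \<and> deriv f \<in> Cset r"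
  by (auto simp: Cset_def funpow_Suc_right less_Suc_eq_0_disj simp del: funpow.simps)

lemma Cset_Suc_deriv:
  "f \<in> Cset (Suc r) \<Longrightarrow> x > 0 \<Longrightarrow> (f has_real_derivative deriv f x) (at x)"
  by (simp add: Cset_Suc DERIV_deriv_iff_real_differentiable)

lemma Cset_imp_continuous_on: "f \<in> Cset r \<Longrightarrow> continuous_on {0<..} f"
  by (cases r)
    (auto simp: Cset_0 intro!: continuous_at_imp_continuous_on DERIV_isCont dest: Cset_Suc_deriv)

lemma eventually_nhds_pos:
  assumes "\<And>x. x > 0 \<Longrightarrow> P x" "x > (0::real)"
  shows "eventually P (nhds x)"
  using eventually_nhds_in_open[of "{0<..}" x] assms by (auto elim: eventually_mono)

lemma deriv_pos_cong:
  fixes f g :: "real \<Rightarrow> real"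
  assumes "\<And>x. x > 0 \<Longrightarrow> f x = g x" "x > 0"
  shows "deriv f x = deriv g x"
  using assms by (intro deriv_cong_ev eventually_nhds_pos) auto

lemma deriv_pow_pos_cong:
  fixes f g :: "real \<Rightarrow> real"
  assumes "\<And>x. x > 0 \<Longrightarrow> f x = g x" "x > 0"
  shows "(deriv ^^ k) f x = (deriv ^^ k) g x"
  using assms(2)
proof (induction k arbitrary: x)
  case (Suc k)
  then show ?case by (auto intro!: deriv_pos_cong)
qed (simp add: assms(1))

lemma Cset_cong:
  assumes "f \<in> Cset r" "\<And>x. x > 0 \<Longrightarrow> f x = g x"
  shows "g \<in> Cset r"
  using assms
proof (induction r arbitrary: f g)
  case 0
  then show ?case
    unfolding Cset_0 by (auto intro: continuous_on_eq)
next
  case (Suc r)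
  have "g differentiable at x" if "x > 0" for x
  proof -
    have "eventually (\<lambda>y. f y = g y) (nhds x)"
      using Suc.prems(2) that by (rule eventually_nhds_pos)
    then have "(g has_real_derivative deriv f x) (at x)"
      using Cset_Suc_deriv[OF Suc.prems(1) that] DERIV_cong_ev by blast
    then show ?thesis
      by (auto simp: real_differentiable_def)
  qed
  moreover have "deriv g \<in> Cset r"
  proof (rule Suc.IH)
    show "deriv f \<in> Cset r"
      using Suc.prems(1) by (simp add: Cset_Suc)
  qed (use Suc.prems(2) in \<open>rule deriv_pos_cong\<close>)
  ultimately show ?case
    by (simp add: Cset_Suc)
qed

lemma Cset_add_const:
  assumes "f \<in> Cset r"
  shows "(\<lambda>x. f x + c) \<in> Cset r"
proof (cases r)
  case 0
  with assms show ?thesis by (auto simp: Cset_0 intro: continuous_intros)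
next
  case (Suc s)
  have D: "((\<lambda>x. f x + c) has_real_derivative deriv f x) (at x)" if "x > 0" for x
    using Cset_Suc_deriv[OF assms[unfolded Suc] that] by (auto intro!: derivative_eq_intros)
  have "deriv (\<lambda>x. f x + c) \<in> Cset s"
  proof (rule Cset_cong)
    show "deriv f \<in> Cset s"
      using assms by (simp add: Suc Cset_Suc)
  qed (simp add: DERIV_imp_deriv[OF D])
  then show ?thesis
    using D by (auto simp: Suc Cset_Suc real_differentiable_def)
qed

lemma deriv_pow_Delta:
  assumes "F \<in> Cset r" "k \<le> r" "x > 0"
  shows "(deriv ^^ k) (Delta F) x = Delta ((deriv ^^ k) F) x"
  using assms(2,3)
proof (induction k arbitrary: x)
  case (Suc k)
  define h where "h = (deriv ^^ k) F"
  have h: "(h has_real_derivative deriv h y) (at y)" if "y > 0" for y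
    using assms(1) Suc.prems(1) that by (simp add: h_def Cset_def DERIV_deriv_iff_real_differentiable)
  have "(deriv ^^ Suc k) (Delta F) x = deriv (Delta h) x"
    using Suc by (simp add: h_def) (intro deriv_pos_cong, auto)
  also have "Delta h = (\<lambda>y. h (y + 1) - h y)"
    by (simp add: Delta_def fun_eq_iff)
  also have "deriv \<dots> x = deriv h (x + 1) - deriv h x"
    using h[of x] h[of "x + 1"] Suc.prems
    by (intro DERIV_imp_deriv DERIV_diff) (simp_all add: DERIV_shift)
  finally show ?case
    by (simp add: h_def Delta_def)
qed simp

lemma has_derivative_Delta_pow:
  assumes "\<And>x. x > 0 \<Longrightarrow> (f has_real_derivative f' x) (at x)" "x > 0"
  shows "((Delta ^^ j) f has_real_derivative (Delta ^^ j) f' x) (at x)"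
  using assms(2)
proof (induction j arbitrary: x)
  case (Suc j)
  have "((\<lambda>x. (Delta ^^ j) f (x + 1) - (Delta ^^ j) f x) has_real_derivative
      (Delta ^^ j) f' (x + 1) - (Delta ^^ j) f' x) (at x)"
    using Suc.IH[of x] Suc.IH[of "x + 1"] Suc.prems
    by (intro DERIV_diff) (simp_all add: DERIV_shift)
  moreover have "(Delta ^^ Suc j) h = (\<lambda>x. (Delta ^^ j) h (x + 1) - (Delta ^^ j) h x)" for h
    by (simp add: Delta_def fun_eq_iff)
  ultimately show ?case by (simp only:)
qed (use assms in simp)

lemma Kset_derivative:
  assumes "f \<in> Kset (Suc p)" "\<And>x. x > 0 \<Longrightarrow> (f has_real_derivative f' x) (at x)"
  shows "f' \<in> Kset p"
proof -
  obtain M s where M: "M \<ge> 0" "s = 1 \<or> s = - 1" "pconvex_on (Suc p) {M<..} (\<lambda>x. s * f x)"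
    using assms(1) by (rule KsetE)
  have "pconvex_on p {M<..} (\<lambda>x. s * f' x)"
    using M(3) by (rule pconvex_on_derivative) (use M(1) assms(2) in \<open>auto intro: DERIV_cmult\<close>)
  with M(1,2) show ?thesis by (rule KsetI)
qed

lemma Kset_antiderivative:
  assumes "f' \<in> Kset p" "\<And>x. x > 0 \<Longrightarrow> (f has_real_derivative f' x) (at x)"
  shows "f \<in> Kset (Suc p)"
proof -
  obtain M s where M: "M \<ge> 0" "s = 1 \<or> s = - 1" "pconvex_on p {M<..} (\<lambda>x. s * f' x)"
    using assms(1) by (rule KsetE)
  have "pconvex_on (Suc p) {M<..} (\<lambda>x. s * f x)"
    using M(3) by (rule pconvex_on_antiderivative) (use M(1) assms(2) in \<open>auto intro: DERIV_cmult\<close>)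
  with M(1,2) show ?thesis by (rule KsetI)
qed

lemma pconvex_on_0_mono:
  assumes "pconvex_on 0 {M<..} f" "M < x" "x < y"
  shows "f x \<le> f y"
proof -
  have "divided_difference f {x, y} \<ge> 0"
    using assms by (intro pconvex_onD[OF assms(1)]) auto
  then show ?thesis
    using divided_difference_insert_insert[of "{}" x y f] assms
    by (simp add: divided_difference_singleton zero_le_divide_iff)
qed

text \<open>The function \<open>(Delta ^^ p) f\<close> is eventually convex or concave, so that its derivative at
  \<open>n + 1\<close> lies between the differences at \<open>n\<close> and \<open>n + 1\<close>.\<close>

lemma Dset_derivative:
  assumes f: "f \<in> Kset (Suc p)" "f \<in> Dset (Suc p)"
    and f': "\<And>x. x > 0 \<Longrightarrow> (f has_real_derivative f' x) (at x)"
  shows "f' \<in> Dset p"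
proof -
  obtain M s where M: "M \<ge> 0" "s = 1 \<or> s = - 1" "pconvex_on (Suc p) {M<..} (\<lambda>x. s * f x)"
    using f(1) by (rule KsetE)
  define h where "h = (Delta ^^ p) (\<lambda>x. s * f x)"
  define h' where "h' = (Delta ^^ p) (\<lambda>x. s * f' x)"
  have deriv: "(h has_real_derivative h' x) (at x)" if "x > 0" for x
    unfolding h_def h'_def using f' that by (intro has_derivative_Delta_pow DERIV_cmult)
  have "pconvex_on 1 {M<..} h"
    unfolding h_def using M(3) by (intro pconvex_on_Delta_pow) simp
  then have conv: "pconvex_on 0 {M<..} h'"
    using deriv M(1) by (intro pconvex_on_derivative[of 0]) auto
  have mono: "h' x \<le> h' y" if "M < x" "x < y" for x y
    using conv that by (rule pconvex_on_0_mono)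
  have between: "h' x \<le> Delta h x \<and> Delta h x \<le> h' (x + 1)" if "M < x" for x
  proof -
    have "\<exists>z>x. z < x + 1 \<and> h (x + 1) - h x = (x + 1 - x) * h' z"
      using that M(1) deriv by (intro MVT2) auto
    then obtain z where "x < z" "z < x + 1" "Delta h x = h' z"
      by (auto simp: Delta_def)
    then show ?thesis
      using mono[of x z] mono[of z "x + 1"] that by auto
  qed
  have lim: "(\<lambda>n. Delta h (real n)) \<longlonglongrightarrow> 0"
    using Dset_cmult[OF f(2), of s] by (simp add: Dset_def h_def)
  have "(\<lambda>n. h' (real n + 1)) \<longlonglongrightarrow> 0"
  proof (rule tendsto_sandwich)
    show "eventually (\<lambda>n. Delta h (real n) \<le> h' (real n + 1)) sequentially"
      "eventually (\<lambda>n. h' (real n + 1) \<le> Delta h (real n + 1)) sequentially"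
      using eventually_real_gt[of M]
      by (eventually_elim, use between in auto)+
    show "(\<lambda>n. Delta h (real n + 1)) \<longlonglongrightarrow> 0"
      using LIMSEQ_ignore_initial_segment[OF lim, of 1] by (simp add: add.commute)
  qed (rule lim)
  then have "(\<lambda>n. s * h' (real (n + 1))) \<longlonglongrightarrow> 0"
    by (intro tendsto_mult_right_zero) (simp add: add.commute)
  then have "(\<lambda>n. s * h' (real n)) \<longlonglongrightarrow> 0"
    by (rule LIMSEQ_offset)
  moreover have "s * h' x = (Delta ^^ p) f' x" for x
    using M(2) by (auto simp: h'_def Delta_pow_cmult)
  ultimately show ?thesis
    by (simp add: Dset_def)
qed

lemma deriv_pow_Kset:
  assumes "f \<in> Cset r" "f \<in> Kset (q + r)"
  shows "(deriv ^^ r) f \<in> Kset q"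
  using assms
proof (induction r arbitrary: f)
  case (Suc r)
  then have "f \<in> Kset (Suc (q + r))" by simp
  then have "deriv f \<in> Kset (q + r)"
    by (rule Kset_derivative) (rule Cset_Suc_deriv[OF Suc.prems(1)])
  then show ?case
    using Suc.IH[of "deriv f"] Suc.prems by (simp add: Cset_Suc funpow_Suc_right del: funpow.simps)
qed simp

lemma deriv_pow_Dset:
  assumes "f \<in> Cset r" "f \<in> Dset (p + r)" "f \<in> Kset (p + r)"
  shows "(deriv ^^ r) f \<in> Dset p"
  using assms
proof (induction r arbitrary: f)
  case (Suc r)
  then have f: "f \<in> Kset (Suc (p + r))" "f \<in> Dset (Suc (p + r))" by simp_all
  have "deriv f \<in> Kset (p + r)"
    using f(1) by (rule Kset_derivative) (rule Cset_Suc_deriv[OF Suc.prems(1)])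
  moreover have "deriv f \<in> Dset (p + r)"
    using f by (rule Dset_derivative) (rule Cset_Suc_deriv[OF Suc.prems(1)])
  ultimately show ?case
    using Suc.IH[of "deriv f"] Suc.prems by (simp add: Cset_Suc funpow_Suc_right del: funpow.simps)
qed simp

text \<open>An antiderivative \<open>G\<close> of \<open>\<Sigma>g'\<close> solves \<open>\<Delta>G = g + c\<close> for some constant \<open>c\<close> and is of one order
  of convexity higher than \<open>\<Sigma>g'\<close>. By uniqueness, \<open>\<Sigma>g\<close> is \<open>G x - c x\<close> up to a constant, so that
  \<open>\<Sigma>g\<close> inherits its smoothness from \<open>\<Sigma>g'\<close>.\<close>

lemma Sigma_op_has_derivative:
  assumes g: "g \<in> Dset (Suc q)" "g \<in> Kset (Suc q)"
    and g': "\<And>x. x > 0 \<Longrightarrow> (g has_real_derivative g' x) (at x)" "continuous_on {0<..} g'"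
  obtains c where "\<And>x. x > 0 \<Longrightarrow> (Sigma_op g has_real_derivative Sigma_op g' x - c) (at x)"
proof -
  have DK: "g' \<in> Dset q" "g' \<in> Kset q"
    using Dset_derivative[OF g(2,1) g'(1)] Kset_derivative[OF g(2) g'(1)] by auto
  note K = Sigma_op_Kset[OF DK order.refl]
  have "continuous_on {0<..} (Sigma_op g')"
    using DK order.refl g'(2) by (rule continuous_on_Sigma_op)
  then have "\<exists>G. \<forall>x. (0::ereal) < ereal x \<longrightarrow> ereal x < \<infinity> \<longrightarrow> (G has_vector_derivative Sigma_op g' x) (at x)"
    by (intro einterval_antiderivative) (auto simp: continuous_on_eq_continuous_at zero_ereal_def)
  then obtain G where G: "(G has_real_derivative Sigma_op g' x) (at x)" if "x > 0" for x
    by (auto simp: has_real_derivative_iff_has_vector_derivative zero_ereal_def)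
  have "((\<lambda>x. Delta G x - g x) has_real_derivative 0) (at x within {0<..})" if "x \<in> {0<..}" for x
  proof -
    have "((\<lambda>x. (G (x + 1) - G x) - g x) has_real_derivative
        (Sigma_op g' (x + 1) - Sigma_op g' x) - g' x) (at x)"
      using G[of x] G[of "x + 1"] g'(1)[of x] that
      by (intro DERIV_diff) (simp_all add: DERIV_shift)
    then show ?thesis
      using Delta_Sigma_op[OF DK order.refl, of x] that
      by (auto simp: Delta_def intro: has_field_derivative_at_within)
  qed
  then obtain c where c: "Delta G x - g x = c" if "x > 0" for x
    using has_field_derivative_zero_constant[of "{0<..}" "\<lambda>x. Delta G x - g x"] by auto
  define H where "H x = G x - c * x - (G 1 - c)" for x
  have H: "(H has_real_derivative Sigma_op g' x + (- c)) (at x)" if "x > 0" for x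
    unfolding H_def using G[OF that] by (auto intro!: derivative_eq_intros)
  have "H \<in> Kset (Suc q)"
    using Kset_add_const[OF K] H by (rule Kset_antiderivative)
  moreover have "Delta H x = g x" if "x > 0" for x
    using c[OF that] by (simp add: H_def Delta_def algebra_simps)
  moreover have "H 1 = 0"
    by (simp add: H_def)
  ultimately have eq: "Sigma_op g x = H x" if "x > 0" for x
    using g that by (intro Sigma_op_eqI)
  show ?thesis
  proof (rule that)
    fix x :: real assume x: "x > 0"
    have "eventually (\<lambda>y. H y = Sigma_op g y) (nhds x)"
      using eq x by (intro eventually_nhds_pos) auto
    then show "(Sigma_op g has_real_derivative Sigma_op g' x - c) (at x)"
      using H[OF x] DERIV_cong_ev[OF refl _ refl, of H "Sigma_op g" x "Sigma_op g' x - c"] by simp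
  qed
qed

lemma Sigma_op_Cset:
  assumes "g \<in> Cset r" "g \<in> Dset q" "g \<in> Kset q" "r \<le> q"
  shows "Sigma_op g \<in> Cset r"
  using assms
proof (induction r arbitrary: g q)
  case 0
  then show ?case
    unfolding Cset_0 by (intro continuous_on_Sigma_op[of g q q] order.refl)
next
  case (Suc r)
  from Suc.prems(4) obtain q' where q: "q = Suc q'"
    by (cases q) auto
  note g' = Cset_Suc_deriv[OF Suc.prems(1)]
  have C: "deriv g \<in> Cset r"
    using Suc.prems(1) by (simp add: Cset_Suc)
  obtain c where c: "\<And>x. x > 0 \<Longrightarrow> (Sigma_op g has_real_derivative Sigma_op (deriv g) x - c) (at x)"
    by (rule Sigma_op_has_derivative[OF Suc.prems(2,3)[unfolded q] g' Cset_imp_continuous_on[OF C]], assumption, rule that)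
  have "Sigma_op (deriv g) \<in> Cset r"
  proof (rule Suc.IH[OF C])
    show "deriv g \<in> Dset q'"
      by (rule Dset_derivative[OF Suc.prems(3,2)[unfolded q] g'])
    show "deriv g \<in> Kset q'"
      by (rule Kset_derivative[OF Suc.prems(3)[unfolded q] g'])
  qed (use Suc.prems q in simp)
  then have "(\<lambda>x. Sigma_op (deriv g) x + (- c)) \<in> Cset r"
    by (rule Cset_add_const)
  then have "deriv (Sigma_op g) \<in> Cset r"
    by (rule Cset_cong) (simp add: DERIV_imp_deriv[OF c])
  then show ?case
    using c by (auto simp: Cset_Suc real_differentiable_def)
qed

section \<open>Iterates\<close>

lemma Delta_rho: "Delta (rho a (Suc p) f) x = rho a p (Delta f) x"
proof -
  have "(\<Sum>j<Suc p. ((x + 1) gchoose j) * (Delta ^^ j) f a) - (\<Sum>j<Suc p. (x gchoose j) * (Delta ^^ j) f a)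
     = (\<Sum>j<p. (x gchoose j) * (Delta ^^ j) (Delta f) a)"
    unfolding sum.lessThan_Suc_shift gbinomial_Suc_Suc
    by (simp add: algebra_simps sum.distrib flip: funpow_swap1)
  then show ?thesis
    by (simp add: rho_def Delta_def[of "rho a (Suc p) f"] Delta_def[of f] add_ac del: sum.lessThan_Suc)
qed

lemma rho_cong:
  assumes "\<And>y. y > 0 \<Longrightarrow> f y = g y" "a > 0" "x + a > 0"
  shows "rho a p f x = rho a p g x"
  using assms Delta_pow_cong[of f g a] by (simp add: rho_def)

text \<open>Passing from \<open>f\<close> to its Newton error subtracts a polynomial of degree below \<open>p\<close>.\<close>

lemma rho_Kset:
  assumes "f \<in> Kset q" "p \<le> Suc q"
  shows "(\<lambda>x. rho a p f (x - a)) \<in> Kset q"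
  using assms(1)
proof (rule Kset_cong_divided_difference)
  fix X :: "real set" assume X: "finite X" "card X = q + 2"
  have "(\<lambda>x. rho a p f (x - a)) = (\<lambda>x. f x - (\<Sum>j<p. (Delta ^^ j) f a * ((x + (- a)) gchoose j)))"
    by (simp add: rho_def fun_eq_iff mult.commute)
  then have "divided_difference (\<lambda>x. rho a p f (x - a)) X =
      divided_difference f X - (\<Sum>j<p. (Delta ^^ j) f a * divided_difference (\<lambda>x. (x + (- a)) gchoose j) X)"
    by (simp only: divided_difference_diff divided_difference_sum divided_difference_cmult)
  also have "\<dots> = divided_difference f X"
  proof -
    have "divided_difference (\<lambda>x. (x + (- a)) gchoose j) X = 0" if "j < p" for j
      using X assms(2) that by (intro divided_difference_gchoose) auto
    then show ?thesis by simp
  qed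
  finally show "divided_difference (\<lambda>x. rho a p f (x - a)) X = divided_difference f X" .
qed

theorem proposition6p5:
  fixes m p r :: nat and f :: "real \<Rightarrow> real"
  assumes "f \<in> Cset r \<inter> Dset (p + r) \<inter> Kset (p + 2 * m + r)"
  shows "f \<in> dom_Sigma_pow (m + 1) \<and>
         (Sigma_op ^^ (m + 1)) f \<in> Cset r \<and>
         (deriv ^^ r) f \<in> dom_Sigma_pow (m + 1) \<and>
         (\<forall>x>0. (Sigma_op ^^ (m + 1)) ((deriv ^^ r) f) x =
                rho 1 (m + 1) ((deriv ^^ r) ((Sigma_op ^^ (m + 1)) f)) (x - 1))"
proof -
  define q where "q = p + 2 * m"
  let ?F = "\<lambda>k. (Sigma_op ^^ k) f" and ?g = "(deriv ^^ r) f"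
  have f: "f \<in> Cset r" "f \<in> Dset (p + r)" "f \<in> Kset (q + r)" "f \<in> Kset (p + r)"
    using assms Kset_antimono[of "p + r" "q + r"] by (auto simp: q_def)
  have F: "?F k \<in> Dset (p + r + k)" "?F k \<in> Kset (q + r)" if "k \<le> m + 1" for k
    using Sigma_op_pow_Dset_Kset[OF f(2,3), of k] that by (auto simp: q_def)
  have F_Cset: "?F k \<in> Cset r" if "k \<le> m + 1" for k
    using that
  proof (induction k)
    case (Suc k)
    then have "?F k \<in> Dset (q + r)"
      using F(1)[of k] Dset_mono[of "p + r + k" "q + r"] by (auto simp: q_def)
    then show ?case
      using Suc F(2)[of k] Sigma_op_Cset[of "?F k" r "q + r"] by simp
  qed (use f in simp)
  have g: "?g \<in> Dset p" "?g \<in> Kset q"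
    using deriv_pow_Dset[OF f(1,2,4)] deriv_pow_Kset[OF f(1,3)] by auto
  \<comment> \<open>The right-hand side for \<open>k + 1\<close> vanishes at 1 and has the right-hand side for \<open>k\<close> as its
    difference, hence it is \<open>\<Sigma>\<close> of the latter. Uniqueness is used at order \<open>q\<close>, which is
    large enough to absorb the polynomial of degree \<open>k\<close> inside \<open>rho\<close>.\<close>
  have main: "(Sigma_op ^^ k) ?g x = rho 1 k ((deriv ^^ r) (?F k)) (x - 1)"
    if "k \<le> m + 1" "x > 0" for k x
    using that
  proof (induction k arbitrary: x)
    case 0
    then show ?case by (simp add: rho_def)
  next
    case (Suc k)
    define u where "u = (deriv ^^ r) (?F k)"
    define v where "v = (deriv ^^ r) (?F (Suc k))"
    have Delta_v: "Delta v y = u y" if "y > 0" for y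
    proof -
      have "Delta v y = (deriv ^^ r) (Delta (?F (Suc k))) y"
        using deriv_pow_Delta[OF F_Cset[OF Suc.prems(1)] order.refl that] by (simp add: v_def)
      also have "\<dots> = u y"
      proof -
        have "Delta (?F (Suc k)) z = ?F k z" if "z > 0" for z
          using Delta_Sigma_op[of "?F k" "p + r + k" "q + r" z] F[of k] Suc.prems that
          by (simp add: q_def)
        then show ?thesis
          unfolding u_def using that by (rule deriv_pow_pos_cong)
      qed
      finally show ?thesis .
    qed
    have "(Sigma_op ^^ k) ?g \<in> Dset (p + k) \<inter> Kset q"
      using Suc.prems by (intro Sigma_op_pow_Dset_Kset g) (simp add: q_def)
    then have Dq: "(Sigma_op ^^ k) ?g \<in> Dset q" and Kq: "(Sigma_op ^^ k) ?g \<in> Kset q"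
      using Dset_mono[of "p + k" q] Suc.prems by (auto simp: q_def)
    have "v \<in> Kset q"
      unfolding v_def
      by (rule deriv_pow_Kset[OF F_Cset[OF Suc.prems(1)] F(2)[OF Suc.prems(1)]])
    then have K: "(\<lambda>y. rho 1 (Suc k) v (y - 1)) \<in> Kset q"
      using Suc.prems by (intro rho_Kset) (auto simp: q_def)
    have D: "Delta (\<lambda>y. rho 1 (Suc k) v (y - 1)) y = (Sigma_op ^^ k) ?g y" if "y > 0" for y
    proof -
      have "Delta (\<lambda>y. rho 1 (Suc k) v (y - 1)) y = Delta (rho 1 (Suc k) v) (y - 1)"
        by (simp add: Delta_def)
      also have "\<dots> = rho 1 k u (y - 1)"
        unfolding Delta_rho using Delta_v that by (intro rho_cong) auto
      finally show ?thesis
        using Suc.IH[of y] Suc.prems that by (simp add: u_def)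
    qed
    have "rho 1 (Suc k) v (1 - 1) = 0"
      using rho_of_nat_eq_0[of 0 "Suc k" 1 v] by simp
    from Sigma_op_eqI[OF Dq Kq K D this Suc.prems(2)] show ?case
      by (simp add: v_def)
  qed
  have "f \<in> dom_Sigma_pow (m + 1)"
    by (rule mem_dom_Sigma_pow[OF f(2,3)]) (simp add: q_def)
  moreover have "?g \<in> dom_Sigma_pow (m + 1)"
    by (rule mem_dom_Sigma_pow[OF g]) (simp add: q_def)
  ultimately show ?thesis
    using main[of "m + 1"] F_Cset[of "m + 1"] by auto
qed

end
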